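(* Let $G$ be a maximal $\{C_3,C_5\}$-free graph on $n$ vertices with minimum degree $\delta(G)>n/5$. For every integer $k\ge 2$, if $G$ contains no copy of $F_k$ (as a subgraph), then $G$ is homomorphic to $F_{k-1}$.
   Context: $C_\ell$ is the cycle of length $\ell$. A graph is maximal $\{C_3,C_5\}$-free if it contains no triangle and no 5-cycle as a subgraph, but adding any edge between two non-adjacent vertices creates a triangle or a 5-cycle. For an integer $k\ge1$, $F_k$ is the graph with vertices $x_1,\dots,x_{5k-3}$ in which $x_ix_j$ is an edge iff $|i-j|\equiv 1\pmod 5$ (so $F_1$ is an edge and $F_2=C_7$). $G$ is homomorphic to $H$ if there is a map $f:V(G)\to V(H)$ with $f(u)f(v)\in E(H)$ whenever $uv\in E(G)$. *)

theory Defs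
  imports Complex_Main "Graph_Theory.Graph_Theory"
begin

text \<open>
  A finite simple graph is a \<^locale>\<open>pair_graph\<close>: a finite, loopless, symmetric digraph, in which
  every edge is represented by its two opposite arcs. The degree of a vertex is therefore its
  out-degree.
\<close>

text \<open>Unspecified for the graph without vertices.\<close>
definition min_degree :: "'a pair_pre_digraph \<Rightarrow> nat" where
  "min_degree G = Min (out_degree (with_proj G) ` pverts G)"

definition contains_copy :: "'a pair_pre_digraph \<Rightarrow> 'b pair_pre_digraph \<Rightarrow> bool" where
  "contains_copy G F \<longleftrightarrow>
    (\<exists>H :: 'a pair_pre_digraph.
      subgraph (with_proj H) (with_proj G) \<and> digraph_iso (with_proj F) (with_proj H))"

definition homomorphic_to :: "'a pair_pre_digraph \<Rightarrow> 'b pair_pre_digraph \<Rightarrow> bool" where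
  "homomorphic_to G H \<longleftrightarrow>
    (\<exists>f. f ` pverts G \<subseteq> pverts H \<and> (\<forall>(u, v) \<in> parcs G. (f u, f v) \<in> parcs H))"

text \<open>Only meaningful for \<open>l \<ge> 3\<close>.\<close>
definition cycle_graph :: "nat \<Rightarrow> nat pair_pre_digraph" where
  "cycle_graph l =
    \<lparr>pverts = {0..<l},
     parcs = {(i, j). i < l \<and> j < l \<and> (j = (i + 1) mod l \<or> i = (j + 1) mod l)}\<rparr>"

definition F_graph :: "nat \<Rightarrow> nat pair_pre_digraph" where
  "F_graph k =
    \<lparr>pverts = {1..5 * k - 3},
     parcs = {(i, j). i \<in> {1..5 * k - 3} \<and> j \<in> {1..5 * k - 3} \<and>
                      \<bar>int i - int j\<bar> mod 5 = 1}\<rparr>"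

definition add_edge :: "'a pair_pre_digraph \<Rightarrow> 'a \<Rightarrow> 'a \<Rightarrow> 'a pair_pre_digraph" where
  "add_edge G u v = G\<lparr>parcs := parcs G \<union> {(u, v), (v, u)}\<rparr>"

definition C3_C5_free :: "'a pair_pre_digraph \<Rightarrow> bool" where
  "C3_C5_free G \<longleftrightarrow>
    \<not> contains_copy G (cycle_graph 3) \<and> \<not> contains_copy G (cycle_graph 5)"

definition maximal_C3_C5_free :: "'a pair_pre_digraph \<Rightarrow> bool" where
  "maximal_C3_C5_free G \<longleftrightarrow>
    C3_C5_free G \<and>
    (\<forall>u \<in> pverts G. \<forall>v \<in> pverts G.
      u \<noteq> v \<and> (u, v) \<notin> parcs G \<longrightarrow> \<not> C3_C5_free (add_edge G u v))"

end

theory Submission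
  imports Defs
begin

text \<open>
  A maximal \<open>{C\<^sub>3, C\<^sub>5}\<close>-free graph without isolated vertices is one in which two vertices are adjacent
  iff no walk of length 4 joins them. The degree condition says that, among any finite family of
  vertices, more than a fifth have a common neighbour; on the other hand two vertices joined by a
  walk of length 1 or 3 have no common neighbour. Playing these two facts against each other in small
  configurations shows that there is no induced hexagon, and yields some further local statements
  about vertices near a \<open>C\<^sub>7\<close> or an \<open>F\<^sub>3\<close>.

  Now let \<open>m\<close> be largest with \<open>F\<^sub>m \<subseteq> G\<close>. If every vertex of \<open>G\<close> is a clone of a vertex of this copy, in
  the sense that it is adjacent to all the neighbours of that vertex, then \<open>G\<close> maps to \<open>F\<^sub>m\<close>, because
  \<open>F\<^sub>m\<close> is itself saturated. Otherwise some vertex \<open>v\<close> that is not a clone has a neighbour on a copy of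
  \<open>F\<^sub>m\<close>; if \<open>m \<ge> 2\<close>, its neighbours there are exactly \<open>x\<^sub>4, x\<^sub>9, \<dots>, x\<^bsub>5m-6\<^esub>\<close> up to rotation. The
  walks of length 4 from \<open>v\<close> to its non-neighbours \<open>x\<^sub>2\<close> and \<open>x\<^bsub>5m-4\<^esub>\<close> replace \<open>x\<^bsub>5m-3\<^esub>, x\<^sub>1\<close> by seven new vertices, and the local
  statements provide all the chords needed for a copy of \<open>F\<^bsub>m+1\<^esub>\<close>.
\<close>

section \<open>Dense saturated graphs\<close>

locale dense_maximal =
  fixes V :: "'a set" and adj :: "'a \<Rightarrow> 'a \<Rightarrow> bool"
  assumes finite_V: "finite V"
    and adj_sym: "adj u v \<Longrightarrow> adj v u"
    and adj_V: "adj u v \<Longrightarrow> u \<in> V"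
    and dense: "u \<in> V \<Longrightarrow> card V < 5 * card {v. adj u v}"
    and no_pentagon: "adj u x \<Longrightarrow> adj x y \<Longrightarrow> adj y z \<Longrightarrow> adj z v \<Longrightarrow> \<not> adj u v"
    and saturated: "u \<in> V \<Longrightarrow> v \<in> V \<Longrightarrow> \<not> adj u v \<Longrightarrow> \<exists>x y z. adj u x \<and> adj x y \<and> adj y z \<and> adj z v"
begin

definition close :: "'a \<Rightarrow> 'a \<Rightarrow> bool" where
  "close u v \<longleftrightarrow> (\<exists>x. adj x u \<and> adj x v)"

text \<open>Double counting of the adjacent pairs of a vertex \<open>z\<close> and an entry of
  \<open>vs\<close>: every entry has more than \<open>card V / 5\<close> neighbours, so some
  \<open>z\<close> exceeds the average. Repeated entries act as integer weights.\<close>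

lemma common_neighbour_of_fifth:
  assumes "vs \<noteq> []" "set vs \<subseteq> V"
  obtains z where "z \<in> V" "length vs < 5 * length (filter (adj z) vs)"
proof -
  have fin: "finite {v. adj u v}" for u
    by (rule finite_subset[OF _ finite_V]) (auto dest: adj_V adj_sym)
  have double_count: "(\<Sum>z\<in>V. length (filter (adj z) ws)) = (\<Sum>v\<leftarrow>ws. card {z. adj v z})" for ws
  proof (induction ws)
    case (Cons v ws)
    have "{z. adj v z} = {z \<in> V. adj z v}" by (auto dest: adj_V adj_sym)
    then have "card {z. adj v z} = (\<Sum>z\<in>V. if adj z v then 1 else 0)"
      by (simp add: sum.If_cases[OF finite_V] Int_def)
    moreover have "length (filter (adj z) (v # ws)) = (if adj z v then 1 else 0) + length (filter (adj z) ws)" for z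
      by simp
    ultimately show ?case using Cons by (simp only: sum.distrib) simp
  qed simp
  \<comment> \<open>The summand 1 for non-empty lists carries the strict inequality through the
    induction.\<close>
  have "length ws * card V + (if ws = [] then 0 else 1) \<le> 5 * (\<Sum>v\<leftarrow>ws. card {z. adj v z})" if "set ws \<subseteq> V" for ws
    using that
  proof (induction ws)
    case (Cons v ws)
    then show ?case using dense[of v] by (auto split: if_splits)
  qed simp
  from this[OF assms(2)] have "length vs * card V < 5 * (\<Sum>z\<in>V. length (filter (adj z) vs))"
    using assms(1) double_count[of vs] by simp
  moreover have "5 * (\<Sum>z\<in>V. length (filter (adj z) vs)) \<le> card V * length vs" if "\<And>z. z \<in> V \<Longrightarrow> 5 * length (filter (adj z) vs) \<le> length vs"
    using sum_bounded_above[of V "\<lambda>z. 5 * length (filter (adj z) vs)" "length vs"] that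
    by (simp add: sum_distrib_left)
  ultimately show ?thesis using that by (metis linorder_not_le mult.commute)
qed

end

section \<open>Refutation by certificates\<close>

text \<open>
  A certificate refutes a finite configuration of vertices \<open>0, \<dots>, n - 1\<close>, given by adjacency lists \<open>G\<close>,
  a list \<open>ns\<close> of non-adjacent pairs and a list \<open>fs\<close> of pairs without a common neighbour. Vertices added
  to the configuration get the next free numbers. The node \<open>Degree vs\<close> closes a branch because no vertex
  can be adjacent to more than a fifth of the vertices of \<open>vs\<close>, counted with multiplicity. The nodes
  \<open>Helly\<close> and \<open>Hex\<close> rely on the absence of induced hexagons and are disabled unless the flag \<open>h\<close> is set.
\<close>

datatype cert =
    Degree "nat list"
  | Odd nat nat
  | Clash nat nat
  | SplitEdge nat nat cert cert
  | SplitClose nat nat cert cert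
  | Walk nat nat cert
  | Helly nat nat nat cert
  | Hex nat nat nat nat nat nat cert

definition step :: "nat list list \<Rightarrow> nat list \<Rightarrow> nat list" where
  "step G us = concat (map (nth G) us)"

definition link :: "nat \<Rightarrow> nat \<Rightarrow> nat list list \<Rightarrow> nat list list" where
  "link u v G = G[u := v # G ! u, v := u # (G[u := v # G ! u]) ! v]"

lemma length_link [simp]: "length (link u v G) = length G"
  by (simp add: link_def)

fun path :: "nat list \<Rightarrow> nat list list \<Rightarrow> nat list list" where
  "path (u # v # vs) G = path (v # vs) (link u v G)"
| "path _ G = G"

definition related :: "(nat \<times> nat) list \<Rightarrow> nat \<Rightarrow> nat list" where
  "related fs v = map snd (filter (\<lambda>p. fst p = v) fs) @ map fst (filter (\<lambda>p. snd p = v) fs)"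

definition remove :: "nat list \<Rightarrow> nat list \<Rightarrow> nat list" where
  "remove cs us = filter (\<lambda>u. u \<notin> set cs) us"

text \<open>Branches on whether the first entry is a neighbour of the hypothetical vertex; if it is,
  all entries that cannot share a neighbour with it drop out. Walks of length 1 are covered by those
  of length 3, since the adjacency lists are built symmetrically.\<close>

fun few :: "nat list list \<Rightarrow> (nat \<times> nat) list \<Rightarrow> nat \<Rightarrow> nat list \<Rightarrow> bool" where
  "few G fs b [] = True"
| "few G fs 0 (v # vs) = False"
| "few G fs (Suc b) (v # vs) = (if length vs \<le> b then True else
     few G fs (Suc b) vs \<and> few G fs b (remove (step G (step G (step G [v])) @ related fs v) vs))"

definition near :: "nat list list \<Rightarrow> nat \<Rightarrow> nat \<Rightarrow> bool" where
  "near G u v = (u < length G \<and> v \<in> set (step G (step G [u])))"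
definition joined :: "nat list list \<Rightarrow> nat \<Rightarrow> nat \<Rightarrow> bool" where
  "joined G u v = (u < length G \<and> v \<in> set (step G [u]))"
text \<open>A 4-walk rules out the edge, which would turn it into a closed 5-walk.\<close>

definition separated :: "nat list list \<Rightarrow> (nat \<times> nat) list \<Rightarrow> nat \<Rightarrow> nat \<Rightarrow> bool" where
  "separated G ns u v = (u < length G \<and> v < length G \<and> v \<in> set (related ns u @ step G (step G (step G (step G [u])))))"

text \<open>\<open>Helly\<close> gives a common neighbour to three vertices that have common
  neighbours pairwise. \<open>Hex\<close> adds the one long diagonal of the hexagon
  \<open>w x u z v y\<close> that is left when the other two are excluded.\<close>

fun check :: "bool \<Rightarrow> nat list list \<Rightarrow> (nat \<times> nat) list \<Rightarrow> (nat \<times> nat) list \<Rightarrow> cert \<Rightarrow> bool" where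
  "check h G ns fs (Degree vs) = (vs \<noteq> [] \<and> list_all (\<lambda>v. v < length G) vs \<and> few G fs (length vs div 5) vs)"
| "check h G ns fs (Odd u v) = (joined G u v \<and> separated G ns u v)"
| "check h G ns fs (Clash u v) = (near G u v \<and> v \<in> set (related fs u))"
| "check h G ns fs (SplitEdge u v c d) = (u < length G \<and> v < length G \<and>
     check h (link u v G) ns fs c \<and> check h G ((u, v) # ns) fs d)"
| "check h G ns fs (SplitClose u v c d) = (u < length G \<and> v < length G \<and>
     check h G ns ((u, v) # fs) c \<and> check h (path [u, length G, v] (G @ [[]])) ns fs d)"
| "check h G ns fs (Walk u v c) = (u < length G \<and> v < length G \<and> v \<in> set (related ns u) \<and>
     check h (path [u, length G, Suc (length G), Suc (Suc (length G)), v] (G @ [[], [], []])) ns fs c)"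
| "check h G ns fs (Helly u v w c) = (h \<and> w < length G \<and> near G u v \<and> near G v w \<and> near G w u \<and>
     check h (path [v, length G, w] (link u (length G) (G @ [[]]))) ns fs c)"
| "check h G ns fs (Hex w z u v x y c) = (h \<and> joined G w x \<and> joined G x u \<and> joined G u z \<and> joined G z v \<and> joined G v y \<and> joined G y w \<and>
     separated G ns x v \<and> separated G ns y u \<and> check h (link w z G) ns fs c)"

section \<open>Soundness of the certificate checker\<close>

context dense_maximal
begin

lemma close_sym: "close u v \<Longrightarrow> close v u"
  by (auto simp: close_def)

text \<open>\<open>e\<close> need not be injective: the rules speak only of walks and adjacency, so
  a refutation also covers degenerate configurations with coinciding vertices.\<close>

definition realizes :: "(nat \<Rightarrow> 'a) \<Rightarrow> nat list list \<Rightarrow> (nat \<times> nat) list \<Rightarrow> (nat \<times> nat) list \<Rightarrow> bool" where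
  "realizes e G ns fs \<longleftrightarrow> (\<forall>u < length G. e u \<in> V)
     \<and> (\<forall>u < length G. \<forall>v \<in> set (G ! u). v < length G \<and> adj (e u) (e v))
     \<and> (\<forall>(u, v) \<in> set ns. u < length G \<and> v < length G \<and> \<not> adj (e u) (e v))
     \<and> (\<forall>(u, v) \<in> set fs. u < length G \<and> v < length G \<and> \<not> close (e u) (e v))"

lemma realizes_step:
  assumes "realizes e G ns fs" "v \<in> set (step G us)" "\<forall>u \<in> set us. u < length G"
  shows "v < length G \<and> (\<exists>u \<in> set us. adj (e u) (e v))"
  using assms by (fastforce simp: step_def realizes_def)

lemma realizes_steps2:
  assumes "realizes e G ns fs" "v \<in> set (step G (step G [u]))" "u < length G"
  shows "v < length G \<and> (\<exists>x. adj (e u) x \<and> adj x (e v))"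
proof -
  have 1: "\<forall>w\<in>set (step G [u]). w < length G \<and> adj (e u) (e w)"
    using realizes_step[OF assms(1)] assms(3) by fastforce
  then show ?thesis using realizes_step[OF assms(1,2)] by blast
qed

lemma realizes_steps3:
  assumes "realizes e G ns fs" "v \<in> set (step G (step G (step G [u])))" "u < length G"
  shows "v < length G \<and> (\<exists>x y. adj (e u) x \<and> adj x y \<and> adj y (e v))"
proof -
  have 1: "\<forall>w\<in>set (step G (step G [u])). w < length G \<and> (\<exists>x. adj (e u) x \<and> adj x (e w))"
    using realizes_steps2[OF assms(1) _ assms(3)] by blast
  then show ?thesis using realizes_step[OF assms(1,2)] by blast
qed

lemma realizes_steps4:
  assumes "realizes e G ns fs" "v \<in> set (step G (step G (step G (step G [u]))))" "u < length G"
  shows "v < length G \<and> (\<exists>x y z. adj (e u) x \<and> adj x y \<and> adj y z \<and> adj z (e v))"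
proof -
  have 1: "\<forall>w\<in>set (step G (step G (step G [u]))). w < length G \<and> (\<exists>x y. adj (e u) x \<and> adj x y \<and> adj y (e w))"
    using realizes_steps3[OF assms(1) _ assms(3)] by blast
  then show ?thesis using realizes_step[OF assms(1,2)] by blast
qed

lemma realizes_related:
  assumes "realizes e G ns fs"
  shows "v \<in> set (related ns u) \<Longrightarrow> \<not> adj (e u) (e v)"
    and "v \<in> set (related fs u) \<Longrightarrow> \<not> close (e u) (e v)"
  using assms unfolding realizes_def related_def by (fastforce dest: adj_sym close_sym)+

lemma realizes_joined: "realizes e G ns fs \<Longrightarrow> joined G u v \<Longrightarrow> adj (e u) (e v)"
  unfolding joined_def using realizes_step[of e G ns fs v "[u]"] by auto

lemma realizes_near: "realizes e G ns fs \<Longrightarrow> near G u v \<Longrightarrow> v < length G \<and> close (e u) (e v)"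
  unfolding near_def close_def using realizes_steps2[of e G ns fs v u] by (blast dest: adj_sym)

lemma realizes_separated:
  assumes "realizes e G ns fs" "separated G ns u v"
  shows "\<not> adj (e u) (e v)"
proof (cases "v \<in> set (related ns u)")
  case False
  then have "v \<in> set (step G (step G (step G (step G [u]))))" "u < length G"
    using assms(2) by (auto simp: separated_def)
  then show ?thesis using realizes_steps4[OF assms(1)] no_pentagon by meson
qed (use realizes_related(1)[OF assms(1)] in blast)

lemma realizes_link:
  assumes "realizes e G ns fs" "u < length G" "v < length G" "adj (e u) (e v)"
  shows "realizes e (link u v G) ns fs"
  using assms adj_sym[OF assms(4)] unfolding realizes_def link_def
  by (auto simp: nth_list_update)

lemma realizes_path:
  assumes "realizes e G ns fs" "\<forall>u \<in> set vs. u < length G" "successively (\<lambda>u v. adj (e u) (e v)) vs"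
  shows "realizes e (path vs G) ns fs"
  using assms
proof (induction vs G rule: path.induct)
  case (1 u v vs G)
  then have "realizes e (link u v G) ns fs" by (intro realizes_link) auto
  then show ?case using 1 by (simp add: link_def)
qed simp_all

lemma realizes_fresh:
  assumes "realizes e G ns fs" "z \<in> V"
  shows "realizes (e(length G := z)) (G @ [[]]) ns fs"
  using assms unfolding realizes_def by (fastforce simp: nth_append less_Suc_eq)

text \<open>Two neighbours of \<open>z\<close> are close, hence not a pair in \<open>fs\<close>, and
  no 3-walk joins them, because with \<open>z\<close> it would form a closed 5-walk. So nothing that
  \<open>few\<close> removes after choosing \<open>v\<close> is adjacent to
  \<open>z\<close>.\<close>

lemma few_sound:
  assumes "realizes e G ns fs" "few G fs b vs" "\<forall>v \<in> set vs. v < length G"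
  shows "length (filter (\<lambda>v. adj z (e v)) vs) \<le> b"
  using assms
proof (induction G fs b vs rule: few.induct)
  case (3 G fs b v vs)
  let ?P = "\<lambda>v. adj z (e v)"
  let ?cs = "step G (step G (step G [v])) @ related fs v"
  show ?case
  proof (cases "length vs \<le> b")
    case True
    then show ?thesis using length_filter_le[of ?P "v # vs"] by simp
  next
    case False
    then have few: "few G fs (Suc b) vs" "few G fs b (remove ?cs vs)"
      using 3(4) by simp_all
    have rec: "length (filter ?P vs) \<le> Suc b"
      using 3(1)[OF False 3(3) few(1)] 3(5) by simp
    have rec': "length (filter ?P (remove ?cs vs)) \<le> b"
      using 3(2)[OF False 3(3) few(2)] 3(5) by (simp add: remove_def)
    show ?thesis
    proof (cases "?P v")
      case True
      have "\<not> ?P u" if "u \<in> set ?cs" for u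
      proof
        assume zu: "?P u"
        then have "close (e v) (e u)" using True by (auto simp: close_def)
        then have "u \<notin> set (related fs v)" using realizes_related(2)[OF 3(3)] by blast
        with that have "u \<in> set (step G (step G (step G [v])))" by simp
        then obtain x y where "adj (e v) x" "adj x y" "adj y (e u)"
          using realizes_steps3[OF 3(3)] 3(5) by fastforce
        then show False using no_pentagon[of z "e v" x y "e u"] True zu by blast
      qed
      then have "filter ?P (remove ?cs vs) = filter ?P vs"
        unfolding remove_def filter_filter by (intro filter_cong) auto
      then show ?thesis using rec' True by simp
    qed (use rec in simp)
  qed
qed auto

text \<open>The hexagon property is assumed only under \<open>h\<close>, so the checker can first
  establish it with \<open>h = False\<close> and rely on it afterwards.\<close>

theorem check_sound:
  assumes hexagon: "\<And>u v w x y z. \<lbrakk>h; adj u v; adj v w; adj w x; adj x y; adj y z; adj z u\<rbrakk>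
      \<Longrightarrow> adj u x \<or> adj v y \<or> adj w z"
    and "check h G ns fs c" "realizes e G ns fs"
  shows False
  using assms(2,3)
proof (induction c arbitrary: e G ns fs)
  case (Degree vs)
  have "map e vs \<noteq> []" "set (map e vs) \<subseteq> V"
    using Degree by (auto simp: realizes_def list_all_iff)
  then obtain z where "length (map e vs) < 5 * length (filter (adj z) (map e vs))"
    by (rule common_neighbour_of_fifth)
  moreover have "length (filter (\<lambda>v. adj z (e v)) vs) \<le> length vs div 5"
    using Degree by (intro few_sound) (auto simp: list_all_iff)
  ultimately show False by (simp add: filter_map comp_def)
next
  case (Odd u v)
  then show False using realizes_joined[of e G ns fs u v] realizes_separated[of e G ns fs u v] by simp
next
  case (Clash u v)
  then show False using realizes_near[of e G ns fs u v] realizes_related(2)[of e G ns fs v u] by simp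
next
  case (SplitEdge u v c d)
  have uv: "u < length G" "v < length G" "check h (link u v G) ns fs c" "check h G ((u, v) # ns) fs d"
    using SplitEdge.prems(1) by simp_all
  show False
  proof (cases "adj (e u) (e v)")
    case True
    show False using SplitEdge.IH(1)[OF uv(3) realizes_link[OF SplitEdge.prems(2) uv(1,2) True]] .
  next
    case False
    then have "realizes e G ((u, v) # ns) fs" using SplitEdge.prems(2) uv by (simp add: realizes_def)
    then show False by (rule SplitEdge.IH(2)[OF uv(4)])
  qed
next
  case (SplitClose u v c d)
  have uv: "u < length G" "v < length G" "check h G ns ((u, v) # fs) c"
    "check h (path [u, length G, v] (G @ [[]])) ns fs d"
    using SplitClose.prems(1) by simp_all
  show False
  proof (cases "close (e u) (e v)")
    case True
    then obtain x where x: "adj x (e u)" "adj x (e v)" by (auto simp: close_def)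
    let ?e = "e(length G := x)"
    have "realizes ?e (G @ [[]]) ns fs"
      using realizes_fresh[OF SplitClose.prems(2) adj_V[OF x(1)]] .
    then have "realizes ?e (path [u, length G, v] (G @ [[]])) ns fs"
      by (rule realizes_path) (use uv x adj_sym[OF x(1)] in simp_all)
    then show False by (rule SplitClose.IH(2)[OF uv(4)])
  next
    case False
    then have "realizes e G ns ((u, v) # fs)" using SplitClose.prems(2) uv by (simp add: realizes_def)
    then show False by (rule SplitClose.IH(1)[OF uv(3)])
  qed
next
  case (Walk u v c)
  let ?n = "length G"
  have uv: "u < ?n" "v < ?n" "v \<in> set (related ns u)"
    "check h (path [u, ?n, Suc ?n, Suc (Suc ?n), v] (G @ [[], [], []])) ns fs c"
    using Walk.prems(1) by simp_all
  have "e u \<in> V" "e v \<in> V" using Walk.prems(2) uv(1,2) by (auto simp: realizes_def)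
  with saturated realizes_related(1)[OF Walk.prems(2) uv(3)]
  obtain x y z where w: "adj (e u) x" "adj x y" "adj y z" "adj z (e v)"
    by blast
  let ?e = "((e(?n := x))(Suc ?n := y))(Suc (Suc ?n) := z)"
  have "realizes (e(?n := x)) (G @ [[]]) ns fs"
    using realizes_fresh[OF Walk.prems(2) adj_V[OF w(2)]] .
  from realizes_fresh[OF this adj_V[OF w(3)]]
  have "realizes ((e(?n := x))(Suc ?n := y)) (G @ [[], []]) ns fs" by simp
  from realizes_fresh[OF this adj_V[OF w(4)]]
  have "realizes ?e (G @ [[], [], []]) ns fs" by simp
  then have "realizes ?e (path [u, ?n, Suc ?n, Suc (Suc ?n), v] (G @ [[], [], []])) ns fs"
    by (rule realizes_path) (use uv w in simp_all)
  then show False by (rule Walk.IH[OF uv(4)])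
next
  case (Helly u v w c)
  have uvw: h "w < length G" "near G u v" "near G v w" "near G w u"
    "check h (path [v, length G, w] (link u (length G) (G @ [[]]))) ns fs c"
    using Helly.prems(1) unfolding check.simps by blast+
  note near = uvw(3-5)[THEN realizes_near[OF Helly.prems(2)]]
  obtain x y z where xyz: "adj x (e u)" "adj x (e v)" "adj y (e v)" "adj y (e w)" "adj z (e w)" "adj z (e u)"
    using near unfolding close_def by blast
  \<comment> \<open>The three common neighbours alternate with \<open>u\<close>, \<open>v\<close>,
    \<open>w\<close> on a hexagon, and any long diagonal makes one of them adjacent to all
    three.\<close>
  have "adj (e u) y \<or> adj x (e w) \<or> adj (e v) z"
    by (rule hexagon[OF uvw(1)]) (use xyz adj_sym in blast)+
  then obtain t where t: "adj t (e u)" "adj t (e v)" "adj t (e w)" using xyz adj_sym by blast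
  let ?e = "e(length G := t)"
  have "realizes ?e (G @ [[]]) ns fs"
    using realizes_fresh[OF Helly.prems(2) adj_V[OF t(1)]] .
  then have "realizes ?e (path [v, length G, w] (link u (length G) (G @ [[]]))) ns fs"
    using near t adj_sym[OF t(1)] adj_sym[OF t(2)] by (intro realizes_path realizes_link) simp_all
  then show False by (rule Helly.IH[OF uvw(6)])
next
  case (Hex w z u v x y c)
  have j: h "joined G w x" "joined G x u" "joined G u z" "joined G z v" "joined G v y" "joined G y w"
    "separated G ns x v" "separated G ns y u" "check h (link w z G) ns fs c"
    using Hex.prems(1) unfolding check.simps by blast+
  have "adj (e w) (e z) \<or> adj (e x) (e v) \<or> adj (e u) (e y)"
    by (rule hexagon) (use j realizes_joined[OF Hex.prems(2)] in simp_all)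
  then have "adj (e w) (e z)"
    using realizes_separated[OF Hex.prems(2)] j(8,9) adj_sym by blast
  moreover have "w < length G" "z < length G"
    using j(2,5) by (auto simp: joined_def)
  ultimately have "realizes e (link w z G) ns fs"
    using realizes_link[OF Hex.prems(2)] by blast
  then show False by (rule Hex.IH[OF j(10)])
qed

end

text \<open>
  The certificates were found by a computer search, the lists in the \<open>Degree\<close> nodes by linear
  programming.
\<close>

lemma hexagon_certificate:
  "check False (fold path [[0, 1, 2, 3, 4, 5, 0]] (replicate 6 [])) [(0, 3), (1, 4), (2, 5)] []
      (Walk 0 3 (Walk 1 4 (Walk 2 5 (SplitClose 11 6 (SplitClose 9 8 (SplitClose 13 6 (SplitClose
      13 9 (Degree [3, 4, 6, 9, 13]) (SplitClose 14 8 (SplitClose 10 6 (Degree [0, 3, 6, 10, 13])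
      (SplitClose 13 7 (SplitClose 12 7 (Degree [3, 4, 5, 6, 7, 8, 9, 12, 13, 14]) (SplitClose 12
      11 (Degree [0, 1, 2, 3, 4, 5, 6, 7, 8, 9, 10, 11, 12, 13, 14]) (Degree [0, 0, 1, 4, 5, 5, 6,
      8, 9, 9, 10, 11, 11, 12, 12, 13, 13, 14, 15, 18]))) (Degree [0, 2, 3, 5, 6, 7, 8, 12, 13,
      14]))) (SplitClose 12 7 (Degree [0, 2, 3, 5, 6, 7, 8, 12, 13, 14]) (Degree [0, 1, 2, 6, 7,
      8, 12, 13, 14, 16])))) (SplitClose 14 8 (SplitClose 13 10 (SplitClose 12 11 (SplitClose 14 9
      (SplitClose 10 7 (Degree [0, 1, 2, 3, 4, 5, 6, 7, 8, 9, 10, 11, 12, 13, 14]) (Degree [0, 1,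
      3, 4, 6, 7, 8, 9, 10, 11])) (Degree [2, 3, 4, 6, 9, 10, 11, 12, 13, 14])) (SplitClose 14 9
      (Degree [0, 1, 5, 8, 9, 10, 11, 12, 13, 14]) (Degree [1, 2, 4, 5, 9, 10, 11, 12, 13, 14])))
      (Degree [1, 2, 4, 5, 9, 10, 11, 12, 13, 14])) (Degree [0, 1, 2, 6, 7, 8, 12, 13, 14, 16])))
      (SplitClose 10 7 (Degree [0, 4, 5, 6, 7, 8, 9, 10, 11, 15]) (Degree [0, 1, 3, 4, 6, 7, 8, 9,
      10, 11]))) (SplitClose 9 8 (SplitClose 10 7 (Degree [1, 2, 3, 6, 7, 8, 9, 10, 11, 15])
      (Degree [0, 1, 3, 4, 6, 7, 8, 9, 10, 11])) (Degree [0, 1, 3, 4, 6, 7, 8, 9, 10, 11]))))))"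
  by code_simp

text \<open>Vertices 0 to 11 with the long diagonals form \<open>F_3\<close>, whose edges are the
  index differences 1, 6 and 11; vertex 12 is attached to 0.\<close>

lemma twelve_cycle_certificate:
  "check True (fold path [[0, 1, 2, 3, 4, 5, 6, 7, 8, 9, 10, 11, 0], [0, 6], [1, 7], [2, 8], [3, 9],
        [4, 10], [5, 11], [12, 0]] (replicate 13 [])) [(12, 5), (12, 7)] []
      (Walk 12 5 (Walk 12 7 (SplitClose 13 2 (SplitClose 13 8 (Degree [2, 5, 8, 11, 13])
      (SplitClose 13 3 (SplitClose 14 3 (SplitClose 12 4 (Degree [0, 2, 3, 4, 5, 6, 8, 12, 13,
      14]) (SplitClose 14 2 (Degree [0, 2, 3, 5, 6, 8, 9, 11, 13, 14]) (Degree [0, 1, 2, 3, 4, 5,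
      12, 13, 14, 15]))) (Helly 14 5 3 (Hex 10 21 3 5 9 11 (Degree [0, 1, 2, 8, 10, 11, 13, 14,
      19, 21])))) (SplitClose 15 1 (SplitClose 14 2 (Degree [0, 1, 2, 3, 5, 6, 13, 14, 15, 20])
      (Degree [0, 1, 2, 3, 4, 5, 12, 13, 14, 15])) (Degree [0, 1, 2, 3, 4, 5, 12, 13, 14, 15]))))
      (Helly 13 2 0 (Hex 7 20 0 2 6 8 (SplitClose 12 9 (SplitClose 13 9 (Degree [5, 9, 12, 13,
      18]) (SplitEdge 13 8 (Hex 13 6 0 7 12 8 (Odd 13 6)) (Hex 21 7 8 20 9 13 (Hex 13 6 0 7 12 21
      (Odd 13 6))))) (SplitEdge 12 10 (Hex 10 6 0 5 12 4 (Odd 10 6)) (Hex 21 11 0 10 12 9 (Hex 21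
      4 3 5 9 11 (Hex 21 6 0 5 12 4 (Odd 21 6)))))))))))"
  by code_simp

text \<open>Numbers 0 to 6 are the heptagon; 7, 8, 9, 10 stand for \<open>v\<close>,
  \<open>p\<close>, \<open>q\<close>, \<open>a\<close> on a 4-walk from \<open>v\<close> to vertex
  2.\<close>

lemma heptagon_certificate:
  "check True (fold path [[0, 1, 2, 3, 4, 5, 6, 0], [4, 7, 8, 9, 10, 2]] (replicate 11 []))
      [(7, 2), (7, 6), (8, 5), (8, 0)] []
      (Walk 7 6 (Walk 8 5 (Walk 8 0 (SplitClose 8 6 (SplitClose 14 0 (SplitClose 7 0 (SplitClose 9
      6 (SplitClose 8 0 (SplitClose 9 0 (Degree [0, 3, 6, 8, 9]) (Helly 9 2 0 (SplitClose 14 3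
      (SplitClose 14 6 (Degree [0, 3, 6, 8, 14]) (SplitClose 22 2 (Degree [0, 2, 3, 4, 6, 7, 8,
      14, 21, 22]) (Degree [2, 3, 4, 5, 6, 8, 9, 14, 21, 22]))) (SplitClose 14 6 (Degree [2, 5, 6,
      8, 14]) (Degree [2, 3, 4, 5, 6, 8, 9, 14, 21, 23]))))) (SplitClose 10 5 (Degree [0, 2, 3, 4,
      5, 6, 8, 9, 10, 20]) (Degree [0, 1, 2, 4, 5, 6, 7, 8, 9, 10]))) (SplitClose 8 1 (Degree [0,
      1, 2, 4, 5, 6, 7, 8, 9, 10]) (Degree [0, 1, 2, 3, 4, 6, 7, 8, 9, 20]))) (Hex 5 20 0 7 6 4
      (SplitClose 15 1 (SplitClose 15 13 (Degree [1, 4, 7, 13, 15]) (Helly 15 13 5 (SplitClose 15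
      2 (SplitClose 14 3 (SplitClose 14 1 (Degree [0, 1, 2, 3, 4, 6, 7, 8, 14, 15]) (SplitClose 15
      3 (Degree [2, 3, 14, 15, 20]) (SplitEdge 24 5 (Degree [0, 1, 2, 3, 7, 8, 14, 15, 20, 24])
      (Hex 16 3 4 24 5 15 (Hex 22 3 4 24 5 15 (Degree [0, 1, 2, 3, 7, 8, 13, 14, 16, 20]))))))
      (Hex 7 23 3 14 4 8 (SplitClose 14 1 (SplitClose 9 0 (Degree [0, 1, 2, 3, 4, 6, 7, 8, 9, 15])
      (Degree [1, 2, 3, 4, 5, 6, 8, 9, 14, 15])) (Hex 3 24 1 14 2 23 (Hex 14 4 3 7 24 8 (Odd 14
      4)))))) (SplitClose 9 5 (SplitClose 10 6 (Degree [2, 4, 5, 6, 7, 8, 9, 10, 15, 23]) (Degree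
      [2, 3, 4, 5, 6, 8, 9, 10, 14, 15])) (Degree [2, 3, 4, 5, 6, 8, 9, 10, 14, 15])))))
      (SplitClose 21 13 (SplitClose 14 3 (SplitClose 21 7 (Degree [0, 1, 3, 4, 6, 7, 8, 13, 14,
      21]) (Hex 22 0 1 20 21 7 (Hex 7 6 0 5 22 4 (Odd 7 6)))) (Hex 7 22 3 14 4 8 (Degree [0, 1, 2,
      3, 5, 14, 15, 16, 20, 22]))) (Helly 21 13 0 (SplitClose 13 2 (Degree [2, 5, 6, 7, 8, 12, 13,
      15, 20, 21]) (Helly 21 13 2 (SplitClose 23 8 (SplitClose 13 8 (Degree [7, 8, 13, 16, 23])
      (Degree [2, 4, 5, 6, 7, 8, 13, 14, 15, 25])) (Hex 26 20 0 7 23 8 (Hex 26 6 5 13 20 23 (Clash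
      6 8))))))))))) (SplitClose 14 13 (SplitClose 14 2 (Degree [2, 5, 6, 8, 14]) (Helly 14 2 0
      (SplitClose 7 0 (SplitClose 19 4 (SplitClose 19 3 (Degree [0, 3, 4, 7, 8, 13, 14, 16, 19,
      22]) (Helly 22 19 3 (SplitClose 24 16 (Degree [4, 5, 7, 8, 13, 14, 16, 19, 22, 24])
      (SplitClose 19 7 (Degree [0, 7, 8, 16, 19]) (SplitEdge 24 15 (Degree [0, 5, 6, 7, 8, 14, 15,
      16, 19, 26]) (Hex 25 14 15 22 16 24 (Hex 24 20 0 14 19 25 (Hex 16 3 4 24 5 25 (Hex 20 16 3
      15 24 14 (Odd 20 16)))))))))) (SplitClose 18 3 (SplitClose 17 2 (Degree [2, 3, 4, 8, 14, 17,
      18, 19, 22, 23]) (Degree [0, 2, 3, 4, 6, 7, 8, 17, 18, 22])) (Degree [0, 2, 3, 4, 7, 8, 17,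
      18, 19, 22]))) (Hex 5 23 0 7 6 4 (Hex 14 23 0 7 22 8 (Odd 14 23)))))) (SplitClose 16 12
      (SplitClose 15 11 (Degree [5, 6, 7, 8, 11, 12, 13, 14, 15, 16]) (Degree [4, 5, 7, 11, 12,
      13, 14, 15, 16, 21])) (Degree [4, 5, 7, 11, 12, 13, 14, 15, 16, 21])))) (Hex 20 4 5 7 6 8
      (SplitClose 15 10 (SplitClose 15 0 (Degree [0, 4, 10, 15, 17]) (Helly 15 5 0 (SplitClose 15
      2 (SplitClose 14 3 (Degree [0, 2, 3, 4, 8, 10, 14, 15, 20, 22]) (SplitClose 22 10 (Degree
      [2, 4, 7, 8, 10, 12, 13, 15, 20, 22]) (Degree [2, 3, 4, 5, 8, 9, 10, 14, 15, 22])))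
      (SplitClose 9 5 (SplitClose 22 10 (Degree [2, 4, 5, 8, 9, 10, 15, 20, 22, 23]) (Degree [2,
      3, 4, 5, 8, 9, 10, 14, 15, 22])) (Degree [2, 3, 4, 5, 8, 9, 10, 14, 15, 16]))))) (Helly 15
      10 8 (SplitClose 13 2 (SplitClose 15 13 (Degree [2, 6, 7, 13, 15]) (Helly 15 13 5
      (SplitClose 24 2 (Degree [2, 7, 8, 13, 24]) (SplitEdge 24 3 (Hex 20 24 3 13 4 6 (Odd 20 24))
      (Hex 4 25 2 24 3 5 (Hex 24 20 4 6 25 13 (Odd 24 20))))))) (SplitClose 8 1 (SplitClose 22 13
      (SplitClose 16 2 (Degree [1, 2, 4, 5, 7, 8, 10, 13, 16, 22]) (Helly 22 16 2 (SplitClose 11 2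
      (Degree [2, 4, 5, 6, 7, 11, 13, 22, 23, 25]) (Degree [1, 5, 6, 7, 8, 11, 13, 16, 22, 25]))))
      (Hex 24 20 6 8 13 22 (SplitEdge 13 10 (Hex 10 20 6 8 13 22 (Odd 10 20)) (Hex 22 23 2 13 10
      24 (Hex 23 20 6 8 13 22 (Odd 23 20)))))) (Hex 24 6 0 20 1 8 (Hex 8 5 4 6 7 24 (Odd 8
      5))))))))))))"
  by code_simp

text \<open>The same numbering, now with the edge from \<open>p\<close> to 5 known; what is refuted
  is the absence of an edge from \<open>q\<close> to 6.\<close>

lemma heptagon_certificate':
  "check True (fold path [[0, 1, 2, 3, 4, 5, 6, 0], [4, 7, 8, 9, 10, 2], [8, 5]] (replicate 11 []))
      [(7, 2), (7, 6), (9, 6)] []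
      (Walk 7 6 (Walk 9 6 (SplitClose 15 2 (SplitClose 15 7 (SplitClose 13 2 (Degree [2, 7, 8, 13,
      15]) (SplitClose 15 4 (Degree [4, 7, 10, 13, 15]) (SplitClose 15 12 (Degree [2, 5, 8, 12,
      15]) (SplitClose 13 9 (SplitClose 12 9 (Degree [2, 3, 4, 5, 8, 9, 12, 13, 14, 15]) (Helly 15
      12 9 (Degree [2, 3, 4, 5, 8, 9, 13, 15, 17, 21]))) (Hex 20 5 6 8 13 9 (Degree [4, 7, 9, 11,
      12, 13, 14, 15, 18, 20])))))) (Helly 15 9 7 (SplitClose 16 3 (SplitClose 16 10 (Degree [2,
      3, 4, 5, 6, 9, 10, 15, 16, 18]) (SplitClose 15 3 (Degree [2, 3, 8, 15, 16]) (Degree [2, 3,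
      5, 6, 8, 9, 10, 15, 16, 20]))) (Hex 5 19 3 16 4 6 (SplitClose 16 10 (SplitClose 9 0 (Degree
      [0, 2, 3, 4, 5, 6, 9, 10, 15, 18]) (Degree [0, 2, 3, 4, 6, 7, 10, 15, 16, 18])) (Hex 20 3 2
      19 10 16 (Hex 16 4 3 5 20 6 (Odd 16 4)))))))) (SplitClose 15 12 (SplitClose 12 3 (Degree [0,
      3, 8, 12, 15]) (Helly 15 9 2 (Helly 12 7 3 (SplitClose 19 12 (SplitClose 13 9 (Degree [3, 5,
      6, 8, 9, 12, 13, 15, 19, 20]) (Hex 21 5 6 8 13 9 (SplitClose 13 2 (Degree [2, 6, 7, 13, 14])
      (Hex 9 22 2 13 19 21 (Hex 12 2 3 22 20 13 (Clash 12 19)))))) (SplitClose 16 7 (SplitClose 20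
      15 (Degree [2, 5, 6, 7, 8, 12, 15, 16, 19, 20]) (Degree [6, 7, 8, 9, 12, 13, 15, 16, 19,
      20])) (Degree [6, 7, 8, 9, 11, 12, 13, 15, 16, 19])))))) (Helly 15 12 6 (SplitClose 12 2
      (Helly 15 9 2 (SplitClose 19 3 (SplitClose 12 3 (Degree [2, 3, 8, 12, 19]) (SplitClose 21 9
      (Degree [2, 3, 5, 6, 8, 9, 12, 19, 20, 21]) (Hex 11 3 4 21 7 12 (Degree [2, 3, 5, 6, 8, 9,
      11, 12, 19, 20])))) (Hex 5 21 3 19 4 6 (Hex 15 3 2 21 20 19 (Hex 19 4 3 5 15 6 (Odd 19
      4)))))) (SplitClose 7 0 (SplitClose 11 1 (Degree [0, 1, 2, 4, 5, 6, 7, 11, 12, 20]) (Degree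
      [0, 1, 2, 3, 4, 6, 7, 11, 12, 13])) (Degree [0, 1, 2, 3, 4, 6, 7, 11, 12, 13]))))))))"
  by code_simp

section \<open>Local structure\<close>

context dense_maximal
begin

text \<open>The number of a vertex is its position in \<open>cs\<close>, and each list in
  \<open>pss\<close> is a walk of the initial configuration.\<close>

lemma certificate_refutes:
  assumes "check h (fold path pss (replicate k [])) ns [] c"
    and "\<And>u v w x y z. \<lbrakk>h; adj u v; adj v w; adj w x; adj x y; adj y z; adj z u\<rbrakk>
      \<Longrightarrow> adj u x \<or> adj v y \<or> adj w z"
    and "length cs = k" "set cs \<subseteq> V"
    and "\<forall>ps \<in> set pss. (\<forall>i \<in> set ps. i < length cs) \<and> successively (\<lambda>i j. adj (cs ! i) (cs ! j)) ps"
    and "\<forall>(i, j) \<in> set ns. i < length cs \<and> j < length cs \<and> \<not> adj (cs ! i) (cs ! j)"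
  shows False
proof (rule check_sound[OF assms(2,1)])
  have length_path: "length (path vs G) = length G" for vs G
    by (induction vs G rule: path.induct) simp_all
  have "realizes (nth cs) (fold path pss G) ns [] \<and> length (fold path pss G) = length cs"
    if "realizes (nth cs) G ns []" "length G = length cs" for G
    using that assms(5)
  proof (induction pss arbitrary: G)
    case (Cons ps pss)
    then show ?case using realizes_path[of "nth cs" G ns "[]" ps] by (simp add: length_path)
  qed simp
  moreover have "realizes (nth cs) (replicate (length cs) []) ns []"
    using assms(3,4,6) by (auto simp: realizes_def)
  ultimately show "realizes (nth cs) (fold path pss (replicate k [])) ns []" using assms(3) by simp
qed

text \<open>Proved with the flag off; this is what permits switching it on for the other three
  certificates.\<close>

lemma hexagon_chord:
  assumes "adj c0 c1" "adj c1 c2" "adj c2 c3" "adj c3 c4" "adj c4 c5" "adj c5 c0"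
  shows "adj c0 c3 \<or> adj c1 c4 \<or> adj c2 c5"
proof (rule ccontr)
  assume "\<not> ?thesis"
  then show False
    using assms[THEN adj_V] assms
    by (intro certificate_refutes[where cs = "[c0, c1, c2, c3, c4, c5]", OF hexagon_certificate]) simp_all
qed

text \<open>Serves to show that the neighbours of a vertex along a copy of \<open>F_m\<close>, taken
  in steps of five, do not break off too early.\<close>

lemma twelve_cycle_neighbour:
  assumes "adj z0 z1" "adj z1 z2" "adj z2 z3" "adj z3 z4" "adj z4 z5" "adj z5 z6"
    "adj z6 z7" "adj z7 z8" "adj z8 z9" "adj z9 z10" "adj z10 z11" "adj z11 z0"
    "adj z0 z6" "adj z1 z7" "adj z2 z8" "adj z3 z9" "adj z4 z10" "adj z5 z11"
    and "adj v z0"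
  shows "adj v z5 \<or> adj v z7"
proof (rule ccontr)
  assume "\<not> ?thesis"
  then show False
    using assms[THEN adj_V] assms
    by (intro certificate_refutes[where cs = "[z0, z1, z2, z3, z4, z5, z6, z7, z8, z9, z10, z11, v]",
          OF twelve_cycle_certificate hexagon_chord]) simp_all
qed

text \<open>The walk \<open>v p q a x2\<close> comes from saturation. In the application
  \<open>x5\<close> runs over several vertices of a copy while the walk stays fixed, so one
  \<open>p\<close> serves them all.\<close>

lemma heptagon_neighbour:
  assumes x: "adj x0 x1" "adj x1 x2" "adj x2 x3" "adj x3 x4" "adj x4 x5" "adj x5 x6" "adj x6 x0"
    and w: "adj x4 v" "adj v p" "adj p q" "adj q a" "adj a x2"
    and v: "\<not> adj v x2" "\<not> adj v x6"
  shows "adj p x5"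
proof (rule ccontr)
  assume px5: "\<not> adj p x5"
  \<comment> \<open>The certificate needs this second non-adjacency: otherwise
    \<open>p v x4 x5 x6 x0\<close> would be a hexagon without long diagonals.\<close>
  have "\<not> adj p x0"
  proof
    assume "adj p x0"
    then have "adj p x5 \<or> adj v x6 \<or> adj x4 x0"
      using hexagon_chord[of p v x4 x5 x6 x0] x w adj_sym by blast
    then show False using px5 v no_pentagon[of x4 x3 x2 x1 x0] x adj_sym by blast
  qed
  then show False
    using px5 v x w x[THEN adj_V] w[THEN adj_V]
    by (intro certificate_refutes[where cs = "[x0, x1, x2, x3, x4, x5, x6, v, p, q, a]",
          OF heptagon_certificate hexagon_chord]) simp_all
qed

text \<open>Moves one vertex further along the same walk, once the edge from \<open>p\<close> to
  \<open>x5\<close> is available.\<close>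

lemma heptagon_neighbour':
  assumes "adj x0 x1" "adj x1 x2" "adj x2 x3" "adj x3 x4" "adj x4 x5" "adj x5 x6" "adj x6 x0"
    and "adj x4 v" "adj v p" "adj p q" "adj q a" "adj a x2" "adj p x5"
    and "\<not> adj v x2" "\<not> adj v x6"
  shows "adj q x6"
proof (rule ccontr)
  assume "\<not> adj q x6"
  then show False
    using assms assms(1-13)[THEN adj_V]
    by (intro certificate_refutes[where cs = "[x0, x1, x2, x3, x4, x5, x6, v, p, q, a]",
          OF heptagon_certificate' hexagon_chord]) simp_all
qed

section \<open>Copies of the graphs \<open>F\<^sub>m\<close> and their clones\<close>

text \<open>
  The vertex sequence \<open>x\<^sub>1, \<dots>, x\<^bsub>5m-3\<^esub>\<close> is extended periodically to the integers; adjacency survives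
  the wrap-around because \<open>5m - 3\<close> is 2 modulo 5. Injectivity need not be required, it is automatic.
\<close>

definition copy :: "nat \<Rightarrow> (int \<Rightarrow> 'a) \<Rightarrow> bool" where
  "copy m X \<longleftrightarrow> m \<ge> 1 \<and> (\<forall>i. X (i + (5 * int m - 3)) = X i) \<and>
     (\<forall>i j. i < j \<longrightarrow> j < i + (5 * int m - 3) \<longrightarrow> (j - i) mod 5 = 1 \<longrightarrow> adj (X i) (X j))"

definition clone :: "nat \<Rightarrow> (int \<Rightarrow> 'a) \<Rightarrow> 'a \<Rightarrow> int \<Rightarrow> bool" where
  "clone m X v i \<longleftrightarrow> (\<forall>j. i < j \<longrightarrow> j < i + (5 * int m - 3) \<longrightarrow> (j - i) mod 5 = 1 \<longrightarrow> adj v (X j))"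

section \<open>Shifting, reflecting and constructing copies\<close>

lemma copy_adj:
  assumes "copy m X" "(j - i) mod 5 = 1" "i < j" "j < i + (5 * int m - 3)"
  shows "adj (X i) (X j)" "adj (X j) (X i)"
  using assms adj_sym by (auto simp: copy_def)

lemma copy_shift: "copy m X \<Longrightarrow> copy m (\<lambda>i. X (i + t))"
  unfolding copy_def by (auto simp: add.commute add.left_commute) (smt (verit, ccfv_SIG))+

lemma copy_periodic: "copy m X \<Longrightarrow> X (i + (5 * int m - 3)) = X i"
  by (simp add: copy_def)

lemma copy_periodic_mult:
  assumes "copy m X"
  shows "X (i + k * (5 * int m - 3)) = X i"
proof (induction k rule: int_induct[where k = 0])
  case (step1 k)
  then show ?case using copy_periodic[OF assms, of "i + k * (5 * int m - 3)"] by (simp add: algebra_simps)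
next
  case (step2 k)
  then show ?case using copy_periodic[OF assms, of "i + (k - 1) * (5 * int m - 3)"] by (simp add: algebra_simps)
qed simp

text \<open>Reflection lets a single analysis of the walk from \<open>v\<close> to one end of a copy
  serve for both ends.\<close>

lemma copy_mirror:
  assumes X: "copy m X"
  shows "copy m (\<lambda>i. X (t - i))"
  unfolding copy_def
proof (intro conjI allI impI)
  show "m \<ge> 1" using X by (simp add: copy_def)
  show "X (t - (i + (5 * int m - 3))) = X (t - i)" for i
    using copy_periodic[OF X, of "t - (i + (5 * int m - 3))"] by simp
  show "adj (X (t - i)) (X (t - j))" if "i < j" "j < i + (5 * int m - 3)" "(j - i) mod 5 = 1" for i j
    using that by (intro copy_adj(2)[OF X]) auto
qed

lemma difference_of_residues:
  fixes N c d k :: int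
  assumes "c = d + k * N" "- N < c" "c < N" "0 < d" "d < N"
  shows "k = 0 \<or> k = - 1"
proof -
  have "k * N < 1 * N" "(- 2) * N < k * N" "0 < N" using assms by linarith+
  then have "k < 1" "- 2 < k" by (simp_all only: mult_less_cancel_right_pos)
  then show ?thesis by linarith
qed

text \<open>Reducing \<open>i\<close> and \<open>j\<close> to one period keeps their difference or
  lowers it by \<open>5m - 3\<close>; in the latter case the reversed difference is congruent to 2 -
  1 = 1 modulo 5.\<close>

lemma copyI:
  assumes m: "m \<ge> 1" and g: "\<And>i j. \<lbrakk>1 \<le> i; i < j; j \<le> 5 * int m - 3; (j - i) mod 5 = 1\<rbrakk> \<Longrightarrow> adj (g i) (g j)"
  shows "copy m (\<lambda>i. g ((i - 1) mod (5 * int m - 3) + 1))"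
  unfolding copy_def
proof (intro conjI allI impI)
  let ?N = "5 * int m - 3"
  have N: "?N > 0" using m by simp
  show "m \<ge> 1" by fact
  show "g ((i + ?N - 1) mod ?N + 1) = g ((i - 1) mod ?N + 1)" for i
    using mod_add_self2[of "i - 1" ?N] by (simp add: algebra_simps)
  fix i j assume ij: "i < j" "j < i + ?N" "(j - i) mod 5 = 1"
  define a b where "a = (i - 1) mod ?N" and "b = (j - 1) mod ?N"
  have ab: "0 \<le> a" "a < ?N" "0 \<le> b" "b < ?N" using N by (simp_all add: a_def b_def)
  have "i - 1 = a + (i - 1) div ?N * ?N" "j - 1 = b + (j - 1) div ?N * ?N"
    unfolding a_def b_def using div_mult_mod_eq[of "i - 1" ?N] div_mult_mod_eq[of "j - 1" ?N] by linarith+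
  then obtain k where diff: "b - a = (j - i) + k * ?N"
    by (intro that[of "(i - 1) div ?N - (j - 1) div ?N"]) (simp add: algebra_simps)
  then consider "k = 0" | "k = - 1"
    using difference_of_residues[OF diff] ab ij by linarith
  then have "adj (g (a + 1)) (g (b + 1))"
  proof cases
    case 1
    then show ?thesis using diff ab ij by (intro g) auto
  next
    case 2
    then have "a - b = ?N - (j - i)" using diff by simp
    then have "(a - b) mod 5 = 1" "a > b" using ij by presburger+
    then show ?thesis using ab by (intro adj_sym[OF g]) auto
  qed
  then show "adj (g ((i - 1) mod ?N + 1)) (g ((j - 1) mod ?N + 1))" by (simp add: a_def b_def)
qed

text \<open>The graph \<open>F\<^sub>m\<close> is saturated as well, so adjacent clones come from adjacent vertices.\<close>

lemma adjacent_clones: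
  assumes X: "copy m X" and v: "clone m X v i" and w: "clone m X w j" and vw: "adj v w"
    and ij: "i \<le> j" "j < i + (5 * int m - 3)"
  shows "(j - i) mod 5 = 1"
proof (rule ccontr)
  let ?N = "5 * int m - 3"
  assume ne: "(j - i) mod 5 \<noteq> 1"
  have m: "m \<ge> 1" using X by (simp add: copy_def)
  have v': "adj v (X k)" if "i < k" "k < i + ?N" "(k - i) mod 5 = 1" for k
    using v that by (simp add: clone_def)
  have w': "adj (X k) w" if "j < k" "k < j + ?N" "(k - j) mod 5 = 1" for k
    using w that by (simp add: clone_def adj_sym)
  have False if "adj v (X a)" "adj (X a) (X b)" "adj (X b) (X c)" "adj (X c) w" for a b c
    using no_pentagon[OF that] vw by blast
  note pentagon = this
  \<comment> \<open>For each residue other than 1 the copy provides a 4-walk from \<open>v\<close>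
    to \<open>w\<close>, which excludes the edge between them.\<close>
  consider "(j - i) mod 5 = 0" | "(j - i) mod 5 = 2" | "(j - i) mod 5 = 3" | "(j - i) mod 5 = 4"
  proof -
    have "(j - i) mod 5 = 0 \<or> (j - i) mod 5 = 2 \<or> (j - i) mod 5 = 3 \<or> (j - i) mod 5 = 4"
      using ne by presburger
    then show thesis using that by metis
  qed
  then show False
  proof cases
    case 1
    show False
    proof (rule pentagon)
      show "adj v (X (i + 1))" using m by (intro v') auto
      show "adj (X (i + 1)) (X i)" using m by (intro copy_adj(2)[OF X]) auto
      show "adj (X i) (X (j + 1))" using 1 ij by (intro copy_adj(1)[OF X]) presburger+
      show "adj (X (j + 1)) w" using m by (intro w') auto
    qed
  next
    case 2
    show False
    proof (rule pentagon)
      show "adj v (X (i + 1))" using m by (intro v') auto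
      show "adj (X (i + 1)) (X (i + 2))" using 2 m ij by (intro copy_adj(1)[OF X]) presburger+
      show "adj (X (i + 2)) (X (j + 1))" using 2 ij by (intro copy_adj(1)[OF X]) presburger+
      show "adj (X (j + 1)) w" using m by (intro w') auto
    qed
  next
    case 3
    show False
    proof (rule pentagon)
      show "adj v (X (j + 3))" using 3 ij by (intro v') presburger+
      show "adj (X (j + 3)) (X (j + 2))" using 3 ij by (intro copy_adj(2)[OF X]) presburger+
      show "adj (X (j + 2)) (X (j + 1))" using 3 ij by (intro copy_adj(2)[OF X]) presburger+
      show "adj (X (j + 1)) w" using m by (intro w') auto
    qed
  next
    case 4
    show False
    proof (rule pentagon)
      show "adj v (X (i + 1))" using m by (intro v') auto
      show "adj (X (i + 1)) (X (i + 2))" using 4 ij by (intro copy_adj(1)[OF X]) presburger+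
      show "adj (X (i + 2)) (X (i + 3))" using 4 ij by (intro copy_adj(1)[OF X]) presburger+
      \<comment> \<open>A period is added because \<open>w'\<close> only accepts indices above
        \<open>j\<close>; modulo 5 the difference becomes 3 + 2 - 4 = 1.\<close>
      have "adj (X (i + 3 + ?N)) w" using 4 ij by (intro w') presburger+
      then show "adj (X (i + 3)) w" using copy_periodic[OF X, of "i + 3"] by simp
    qed
  qed
qed

section \<open>Enlarging a copy with the help of a vertex that is not a clone\<close>

lemma nonclone_with_neighbour:
  assumes X: "copy m X" and m: "m \<ge> 2" and w: "w \<in> V" "\<forall>i. \<not> clone m X w i"
  obtains Y v i where "copy m Y" "v \<in> V" "\<forall>i. \<not> clone m Y v i" "adj v (Y i)"
proof -
  let ?N = "5 * int m - 3"
  have X0: "clone m X (X 0) 0" using copy_adj(1)[OF X, of _ 0] by (simp add: clone_def)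
  have X1: "X 0 \<in> V" using copy_adj(1)[OF X, of 1 0] m adj_V by simp
  \<comment> \<open>On a walk from the non-clone \<open>w\<close> to \<open>X 0\<close>, which is a
    clone of itself, some edge leads from a non-clone to a clone.\<close>
  have "\<exists>v u. adj v u \<and> (\<forall>i. \<not> clone m X v i) \<and> (\<exists>i. clone m X u i)"
  proof (cases "adj w (X 0)")
    case False
    with saturated[OF w(1) X1] obtain p q r where "adj w p" "adj p q" "adj q r" "adj r (X 0)" by blast
    then show ?thesis using w(2) X0 by metis
  qed (use w X0 in blast)
  then obtain v u i where v: "adj v u" "\<forall>i. \<not> clone m X v i" and u: "clone m X u i" by blast
  show ?thesis
  proof (cases "\<exists>j. adj v (X j)")
    case True
    then show ?thesis using that[OF X] v adj_V by blast
  next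
    case False
    \<comment> \<open>Putting the clone \<open>u\<close> in the place of \<open>X i\<close> gives
      \<open>v\<close> a neighbour on the copy.\<close>
    define Y where "Y j = (if (j - i) mod ?N = 0 then u else X j)" for j
    have Y: "copy m Y"
      unfolding copy_def
    proof (intro conjI allI impI)
      show "m \<ge> 1" using m by simp
      show "Y (j + ?N) = Y j" for j
      proof -
        have "(j + ?N - i) mod ?N = (j - i) mod ?N"
          using mod_add_self2[of "j - i" ?N] by (simp add: algebra_simps)
        then show ?thesis using copy_periodic[OF X] by (simp add: Y_def)
      qed
      fix j k assume jk: "j < k" "k < j + ?N" "(k - j) mod 5 = 1"
      have period: "X (t + i - j) = X t" if "(j - i) mod ?N = 0" for t j
      proof -
        obtain c where "j - i = c * ?N" using \<open>(j - i) mod ?N = 0\<close> by (metis mod_0_imp_dvd dvd_def mult.commute)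
        then show ?thesis using copy_periodic_mult[OF X, of "t + i - j" c] by (simp add: algebra_simps)
      qed
      have "\<not> ((j - i) mod ?N = 0 \<and> (k - i) mod ?N = 0)"
      proof
        assume "(j - i) mod ?N = 0 \<and> (k - i) mod ?N = 0"
        then have "?N dvd j - i" "?N dvd k - i" by auto
        then have "?N dvd (k - i) - (j - i)" using dvd_diff by blast
        then have "?N dvd k - j" by simp
        then show False using jk zdvd_not_zless[of "k - j" ?N] by simp
      qed
      then consider "(j - i) mod ?N = 0" "(k - i) mod ?N \<noteq> 0" | "(j - i) mod ?N \<noteq> 0" "(k - i) mod ?N = 0"
        | "(j - i) mod ?N \<noteq> 0" "(k - i) mod ?N \<noteq> 0" by metis
      then show "adj (Y j) (Y k)"
      proof cases
        case 1
        have "adj u (X (k + i - j))" using u jk by (auto simp: clone_def)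
        then show ?thesis using period[OF 1(1), of k] 1 by (simp add: Y_def)
      next
        case 2
        have "(j - k) mod 5 = 4" "(?N + j - k) mod 5 = 1" using jk by presburger+
        then have "adj u (X (j + i - k + ?N))" using u jk by (auto simp: clone_def algebra_simps)
        then show ?thesis using period[OF 2(2), of "j"] copy_periodic[OF X, of "j + i - k"] 2 adj_sym
          by (simp add: Y_def)
      next
        case 3
        then show ?thesis using copy_adj(1)[OF X] jk by (simp add: Y_def)
      qed
    qed
    \<comment> \<open>Only positions congruent to \<open>i\<close> carry neighbours of
      \<open>v\<close>, whereas a clone needs both positions next to \<open>j\<close>. These are
      congruent only if \<open>?N\<close> divides \<open>?N - 2\<close>, which fails for
      \<open>m \<ge> 2\<close>.\<close>
    have "\<not> clone m Y v j" for j
    proof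
      assume "clone m Y v j"
      moreover have "(j + ?N - 1 - j) mod 5 = 1" by presburger
      ultimately have "adj v (Y (j + 1))" "adj v (Y (j + ?N - 1))"
        using m unfolding clone_def by simp_all
      then have "(j + 1 - i) mod ?N = 0" "(j + ?N - 1 - i) mod ?N = 0"
        using False by (auto simp: Y_def split: if_splits)
      then have "?N dvd j + 1 - i" "?N dvd j + ?N - 1 - i" by blast+
      then have "?N dvd (j + ?N - 1 - i) - (j + 1 - i)" using dvd_diff by blast
      then have "?N dvd ?N - 2" by (simp add: algebra_simps)
      then show False using zdvd_not_zless[of "?N - 2" ?N] m by simp
    qed
    moreover have "adj v (Y i)" using v by (simp add: Y_def)
    ultimately show ?thesis using that[OF Y] v adj_V by blast
  qed
qed

text \<open>Stepping by 5 around the copy, consider a maximal run of neighbours of \<open>v\<close>.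
  A run of length \<open>m\<close> would make \<open>v\<close> a clone, and one shorter than
  \<open>m - 1\<close> contradicts \<open>twelve_cycle_neighbour\<close>. The final shift moves the
  run to 4, 9, ..., 5m - 6.\<close>

lemma full_run:
  assumes X: "copy m X" and v: "\<forall>i. \<not> clone m X v i" "adj v (X i)"
  obtains Y where "copy m Y" "\<And>s. 0 \<le> s \<Longrightarrow> s \<le> int m - 2 \<Longrightarrow> adj v (Y (4 + 5 * s))"
    "\<not> adj v (Y 2)" "\<not> adj v (Y (- 1))"
proof -
  let ?N = "5 * int m - 3"
  have m: "m \<ge> 1" using X by (simp add: copy_def)
  have "\<exists>t. \<not> adj v (X t) \<and> adj v (X (t + 5))"
  proof (rule ccontr)
    assume "\<not> ?thesis"
    then have "adj v (X (t - 5))" if "adj v (X t)" for t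
      using that by (metis diff_add_cancel)
    note previous = this
    have all: "adj v (X (i - 5 * int k))" for k
    proof (induction k)
      case (Suc k)
      then show ?case using previous[of "i - 5 * int k"] by (simp add: algebra_simps)
    qed (use v in simp)
    have "adj v (X j)" for j
    proof -
      \<comment> \<open>\<open>2m - 1\<close> inverts 5 modulo \<open>?N\<close>, as
        \<open>5 (2m - 1) = 2 ?N + 1\<close>; the added multiple of \<open>?N\<close> makes the
        number of steps non-negative.\<close>
      let ?k = "(i - j) * (2 * int m - 1) + \<bar>i - j\<bar> * ?N"
      have "- \<bar>i - j\<bar> * (2 * int m - 1) \<le> (i - j) * (2 * int m - 1)"
        using m by (intro mult_right_mono) auto
      moreover have "\<bar>i - j\<bar> * (2 * int m - 1) \<le> \<bar>i - j\<bar> * ?N"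
        using m by (intro mult_left_mono) auto
      ultimately have "?k \<ge> 0" by simp
      then have "adj v (X (i - 5 * ?k))" using all[of "nat ?k"] by simp
      moreover have "i - 5 * ?k = j + (- 2 * (i - j) - 5 * \<bar>i - j\<bar>) * ?N"
        by (simp add: algebra_simps)
      ultimately show ?thesis using copy_periodic_mult[OF X] by metis
    qed
    then have "clone m X v 0" by (simp add: clone_def)
    then show False using v by blast
  qed
  then obtain t where t: "\<not> adj v (X t)" "adj v (X (t + 5))" by blast
  define P where "P r \<longleftrightarrow> \<not> adj v (X (t + 5 + 5 * int r))" for r
  define r where "r = (LEAST r. P r)"
  \<comment> \<open>\<open>?N\<close> steps of 5 from \<open>t\<close> lead back to the
    non-neighbour \<open>X t\<close>, so the run ends.\<close>
  have "t + 5 + 5 * int (5 * m - 4) = t + 5 * ?N" using m by (simp add: of_nat_diff)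
  then have "P (5 * m - 4)"
    using t copy_periodic_mult[OF X, of t 5] unfolding P_def by metis
  then have r: "\<not> adj v (X (t + 5 + 5 * int r))"
    using LeastI[of P] by (simp add: r_def P_def)
  have below: "adj v (X (t + 5 + 5 * int s))" if "s < r" for s
    using not_less_Least[of s P] that by (simp add: r_def P_def)
  have "r > 0" using r t(2) by (cases r) auto
  have "r < m"
  proof (rule ccontr)
    assume "\<not> r < m"
    \<comment> \<open>The neighbours of \<open>X (t + 4)\<close> are exactly
      \<open>X (t + 5)\<close>, \<open>X (t + 10)\<close>, ..., \<open>X (t + 5m)\<close>.\<close>
    have "clone m X v (t + 4)"
      unfolding clone_def
    proof (intro allI impI)
      fix j assume j: "t + 4 < j" "j < t + 4 + ?N" "(j - (t + 4)) mod 5 = 1"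
      define s where "s = (j - (t + 4)) div 5"
      have s: "j = t + 5 + 5 * s" using j(3) unfolding s_def by presburger
      with j have "0 \<le> s" "s < int m" by linarith+
      then show "adj v (X j)" using below[of "nat s"] s \<open>\<not> r < m\<close> by simp
    qed
    then show False using v by blast
  qed
  have "r = m - 1"
  proof (rule ccontr)
    assume "r \<noteq> m - 1"
    with \<open>r < m\<close> have rm: "int r \<le> int m - 2" by linarith
    have r1: "int r \<ge> 1" using \<open>r > 0\<close> by simp
    let ?q = "t + 5 * int r"
    \<comment> \<open>The twelve vertices form an \<open>F_3\<close> with \<open>X (t + 5)\<close>
      as \<open>z0\<close> and the two non-neighbours bordering the run, \<open>X (?q + 5)\<close>
      and \<open>X t\<close>, as \<open>z5\<close> and \<open>z7\<close>.\<close>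
    have "adj v (X (?q + 5)) \<or> adj v (X t)"
    proof (rule twelve_cycle_neighbour[of "X (t + 5)" "X (?q + 1)" "X (?q + 2)" "X (?q + 3)" "X (?q + 4)" _
            "X (?q + 6)" _ "X (t + 1)" "X (t + 2)" "X (t + 3)" "X (t + 4)"])
      show "adj v (X (t + 5))" by fact
      show "adj (X (?q + 6)) (X t)" using rm r1 by (intro copy_adj(2)[OF X]) presburger+
      show "adj (X (?q + 1)) (X t)" using rm r1 by (intro copy_adj(2)[OF X]) presburger+
      show "adj (X (?q + 2)) (X (t + 1))" using rm r1 by (intro copy_adj(2)[OF X]) presburger+
      show "adj (X (?q + 3)) (X (t + 2))" using rm r1 by (intro copy_adj(2)[OF X]) presburger+
      show "adj (X (?q + 4)) (X (t + 3))" using rm r1 by (intro copy_adj(2)[OF X]) presburger+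
      show "adj (X (?q + 5)) (X (t + 4))" using rm r1 by (intro copy_adj(2)[OF X]) presburger+
    qed (use rm r1 in \<open>intro copy_adj(1)[OF X]; presburger\<close>)+
    then show False using r t by (simp add: algebra_simps)
  qed
  show ?thesis
  proof (rule that[of "\<lambda>i. X (i + (t + 1))"])
    show "copy m (\<lambda>i. X (i + (t + 1)))" by (rule copy_shift[OF X])
    show "adj v (X (4 + 5 * s + (t + 1)))" if "0 \<le> s" "s \<le> int m - 2" for s
      using below[of "nat s"] that \<open>r = m - 1\<close> by (simp add: algebra_simps)
    have "2 + (t + 1) + ?N = t + 5 + 5 * int r" using \<open>r = m - 1\<close> m by (simp add: of_nat_diff)
    then show "\<not> adj v (X (2 + (t + 1)))" using r copy_periodic[OF X] by metis
    show "\<not> adj v (X (- 1 + (t + 1)))" using t(1) by simp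
  qed
qed

text \<open>Saturation yields the walk from \<open>v\<close> to \<open>X 2\<close>. The heptagon
  lemmas, applied to heptagons through \<open>X 0\<close>, ..., \<open>X 4\<close> with varying last
  vertices, give the chords at \<open>p\<close> and \<open>q\<close>; hexagons give those at
  \<open>a\<close>.\<close>

lemma extend_side:
  assumes X: "copy m X" and m: "m \<ge> 2"
    and v: "\<And>s. 0 \<le> s \<Longrightarrow> s \<le> int m - 2 \<Longrightarrow> adj v (X (4 + 5 * s))" "\<not> adj v (X 2)" "\<not> adj v (X (- 1))"
  obtains p q a where "adj v p" "adj p q" "adj q a" "adj a (X 2)"
    "\<And>i. 1 \<le> i \<Longrightarrow> i \<le> int m - 1 \<Longrightarrow> adj p (X (5 * i))"
    "\<And>i. 1 \<le> i \<Longrightarrow> i \<le> int m - 1 \<Longrightarrow> adj q (X (5 * i + 1))"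
    "\<And>i. 1 \<le> i \<Longrightarrow> i \<le> int m - 2 \<Longrightarrow> adj a (X (5 * i + 2))"
proof -
  let ?N = "5 * int m - 3"
  have v4: "adj (X 4) v" using v(1)[of 0] m adj_sym by simp
  have x: "adj (X 0) (X 1)" "adj (X 1) (X 2)" "adj (X 2) (X 3)" "adj (X 3) (X 4)"
    using m by (auto intro!: copy_adj(1)[OF X])
  have "v \<in> V" "X 2 \<in> V" using adj_V[OF adj_sym[OF v4]] adj_V[OF x(3)] .
  with saturated v(2) obtain p q a where w: "adj v p" "adj p q" "adj q a" "adj a (X 2)" by blast
  have p: "adj p (X (5 * i))" if i: "1 \<le> i" "i \<le> int m - 1" for i
  proof (rule heptagon_neighbour[OF x _ _ _ v4 w v(2)])
    show "adj (X 4) (X (5 * i))" using i by (intro copy_adj(1)[OF X]) presburger+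
    have "adj (X (5 * i)) (X (- 1 + ?N))" using i by (intro copy_adj(1)[OF X]) presburger+
    then show "adj (X (5 * i)) (X (- 1))" using copy_periodic[OF X, of "- 1"] by simp
    show "adj (X (- 1)) (X 0)" using m by (intro copy_adj(1)[OF X]) auto
  qed (rule v(3))
  have q: "adj q (X (5 * i + 1))" if i: "1 \<le> i" "i \<le> int m - 1" for i
  proof (rule heptagon_neighbour'[OF x _ _ _ v4 w p[OF i] v(2)])
    show "adj (X 4) (X (5 * i))" using i by (intro copy_adj(1)[OF X]) presburger+
    show "adj (X (5 * i)) (X (5 * i + 1))" using i by (intro copy_adj(1)[OF X]) presburger+
    have "adj (X (5 * i + 1)) (X (0 + ?N))" using i by (intro copy_adj(1)[OF X]) presburger+
    then show "adj (X (5 * i + 1)) (X 0)" using copy_periodic[OF X, of 0] by simp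
    \<comment> \<open>For the last \<open>i\<close> this vertex is \<open>X (- 1)\<close> up to a
      period; otherwise a 4-walk starting with the last neighbour \<open>X (5m - 6)\<close> of the
      run excludes the edge.\<close>
    show "\<not> adj v (X (5 * i + 1))"
    proof (cases "i = int m - 1")
      case True
      then have "5 * i + 1 = - 1 + ?N" by simp
      then show ?thesis using v(3) copy_periodic[OF X, of "- 1"] by metis
    next
      case False
      show ?thesis
      proof (rule no_pentagon)
        show "adj v (X (4 + 5 * (int m - 2)))" using m by (intro v(1)) auto
        show "adj (X (4 + 5 * (int m - 2))) (X (3 + 5 * (int m - 2)))"
          using m by (intro copy_adj(2)[OF X]) auto
        show "adj (X (3 + 5 * (int m - 2))) (X (2 + 5 * (int m - 2)))"
          using m by (intro copy_adj(2)[OF X]) auto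
        show "adj (X (2 + 5 * (int m - 2))) (X (5 * i + 1))"
          using i False by (intro copy_adj(2)[OF X]) presburger+
      qed
    qed
  qed
  have a: "adj a (X (5 * i + 2))" if i: "1 \<le> i" "i \<le> int m - 2" for i
  proof -
    have qi: "adj q (X (5 * i + 1))" "adj q (X (5 * i + 6))"
      using q[of i] q[of "i + 1"] i by (simp_all add: algebra_simps)
    have y: "adj (X (5 * i + 2)) (X (5 * i + 1))" "adj (X (5 * i + 3)) (X (5 * i + 2))"
      "adj (X (5 * i + 4)) (X (5 * i + 3))" "adj (X (5 * i + 5)) (X (5 * i + 4))"
      "adj (X (5 * i + 6)) (X (5 * i + 5))"
      using i by (auto intro!: copy_adj(2)[OF X])
    \<comment> \<open>This edge closes the hexagon \<open>q\<close>, \<open>a\<close>,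
      \<open>X 2\<close>, \<open>X (5i + 3)\<close>, \<open>X (5i + 2)\<close>,
      \<open>X (5i + 1)\<close>; 4-walks exclude two of its long diagonals.\<close>
    have "adj (X 2) (X (5 * i + 3))" using i by (intro copy_adj(1)[OF X]) presburger+
    then have "adj q (X (5 * i + 3)) \<or> adj a (X (5 * i + 2)) \<or> adj (X 2) (X (5 * i + 1))"
      using hexagon_chord[of q a "X 2" "X (5 * i + 3)" "X (5 * i + 2)" "X (5 * i + 1)"]
        w qi y adj_sym by blast
    moreover have "\<not> adj q (X (5 * i + 3))" using no_pentagon[OF qi(2) y(5,4,3)] .
    moreover have "adj (X 2) (X 3)" "adj (X 3) (X 4)" "adj (X 4) (X 5)" "adj (X 5) (X (5 * i + 1))"
      using i by (intro copy_adj(1)[OF X]; presburger)+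
    then have "\<not> adj (X 2) (X (5 * i + 1))" by (rule no_pentagon)
    ultimately show ?thesis by blast
  qed
  show ?thesis using that[OF w p q a] .
qed

text \<open>\<open>X 1\<close> and \<open>X (5m - 3)\<close> give way to \<open>a\<close> before
  \<open>X 2\<close> and to \<open>b\<close>, \<open>q'\<close>, \<open>p'\<close>,
  \<open>v\<close>, \<open>p\<close>, \<open>q\<close> after \<open>X (5m - 4)\<close>, a gain of
  five vertices.\<close>

lemma copy_extend:
  assumes X: "copy m X" and m: "m \<ge> 2"
    and v: "\<And>s. 0 \<le> s \<Longrightarrow> s \<le> int m - 2 \<Longrightarrow> adj v (X (4 + 5 * s))" "\<not> adj v (X 2)" "\<not> adj v (X (- 1))"
  shows "\<exists>Y. copy (Suc m) Y"
proof -
  let ?N = "5 * int m - 3"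
  obtain p q a where r: "adj v p" "adj p q" "adj q a" "adj a (X 2)"
    and p: "\<And>i. 1 \<le> i \<Longrightarrow> i \<le> int m - 1 \<Longrightarrow> adj p (X (5 * i))"
    and q: "\<And>i. 1 \<le> i \<Longrightarrow> i \<le> int m - 1 \<Longrightarrow> adj q (X (5 * i + 1))"
    and a: "\<And>i. 1 \<le> i \<Longrightarrow> i \<le> int m - 2 \<Longrightarrow> adj a (X (5 * i + 2))"
    by (rule extend_side[OF X m _ v(2,3)]) (blast intro: v(1), rule that)
  have mirror: "X (1 - i) = X (5 * int m - 2 - i)" for i
    using copy_periodic[OF X, of "1 - i"] by (simp add: algebra_simps)
  obtain p' q' b where l: "adj v p'" "adj p' q'" "adj q' b" "adj b (X (1 - 2))"
    and p': "\<And>i. 1 \<le> i \<Longrightarrow> i \<le> int m - 1 \<Longrightarrow> adj p' (X (1 - 5 * i))"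
    and q': "\<And>i. 1 \<le> i \<Longrightarrow> i \<le> int m - 1 \<Longrightarrow> adj q' (X (1 - (5 * i + 1)))"
    and b: "\<And>i. 1 \<le> i \<Longrightarrow> i \<le> int m - 2 \<Longrightarrow> adj b (X (1 - (5 * i + 2)))"
  \<comment> \<open>The reflection taking \<open>i\<close> to \<open>1 - i\<close> exchanges 2 and
    -1 and, up to a period, preserves the set 4, 9, ..., 5m - 6.\<close>
  proof (rule extend_side[OF copy_mirror[OF X, of 1] m])
    show "adj v (X (1 - (4 + 5 * s)))" if "0 \<le> s" "s \<le> int m - 2" for s
      using v(1)[of "int m - 2 - s"] that mirror[of "4 + 5 * s"] by (simp add: algebra_simps)
    show "\<not> adj v (X (1 - 2))" "\<not> adj v (X (1 - - 1))" using v by simp_all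
  qed (rule that)
  have p'': "adj p' (X (5 * i + 3))" if "0 \<le> i" "i \<le> int m - 2" for i
    using p'[of "int m - 1 - i"] that mirror[of "5 * (int m - 1 - i)"] by (simp add: algebra_simps)
  have q'': "adj q' (X (5 * i + 2))" if "0 \<le> i" "i \<le> int m - 2" for i
    using q'[of "int m - 1 - i"] that mirror[of "5 * (int m - 1 - i) + 1"] by (simp add: algebra_simps)
  have b'': "adj b (X (5 * i + 1))" if i: "1 \<le> i" "i \<le> int m - 1" for i
  proof (cases "i = int m - 1")
    case True
    then have eq: "5 * i + 1 = 5 * int m - 2 - 2" by simp
    show ?thesis using l(4) unfolding eq mirror[of 2, symmetric] .
  next
    case False
    then show ?thesis
      using b[of "int m - 1 - i"] i mirror[of "5 * (int m - 1 - i) + 2"] by (simp add: algebra_simps)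
  qed
  have a'': "adj a (X (5 * i + 2))" if "0 \<le> i" "i \<le> int m - 2" for i
    using a[of i] r(4) that by (cases "i = 0") auto
  \<comment> \<open>The wanted edge is a long diagonal of the hexagon \<open>q\<close>,
    \<open>a\<close>, \<open>X 2\<close>, \<open>q'\<close>, \<open>b\<close>, \<open>?y\<close>;
    the walk \<open>q p v p' q'\<close> and a walk along the copy exclude the other two.\<close>
  have ab: "adj a b"
  proof -
    let ?y = "X (5 * (int m - 1) + 1)"
    have "adj q (?y)" "adj b ?y" using q[of "int m - 1"] b''[of "int m - 1"] m by auto
    moreover have "adj q' (X 2)" using q''[of 0] m by simp
    ultimately have "adj q q' \<or> adj a b \<or> adj (X 2) ?y"
      using hexagon_chord[of q a "X 2" q' b ?y] r l adj_sym by blast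
    moreover have "\<not> adj q q'" using no_pentagon[of q p v p' q'] r l adj_sym by blast
    moreover have "adj (X 2) (X 3)" "adj (X 3) (X 4)" "adj (X 4) (X 5)" "adj (X 5) ?y"
      using m by (intro copy_adj(1)[OF X]; presburger)+
    then have "\<not> adj (X 2) ?y" by (rule no_pentagon)
    ultimately show ?thesis by blast
  qed
  define g where "g i = (if i = 1 then a else if i < ?N then X i else if i = ?N then b else
      if i = ?N + 1 then q' else if i = ?N + 2 then p' else if i = ?N + 3 then v else
      if i = ?N + 4 then p else q)" for i
  have "adj (g i) (g j)" if "1 \<le> i" "i < j" "j \<le> 5 * int (Suc m) - 3" "(j - i) mod 5 = 1" for i j
  proof -
    have ge: "1 \<le> i" "i < j" "j \<le> ?N + 5" using that by simp_all
    consider "j < ?N" | "j = ?N" | "j = ?N + 1" | "j = ?N + 2" | "j = ?N + 3" | "j = ?N + 4" | "j = ?N + 5"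
      using ge by linarith
    then show ?thesis
    proof cases
      case 1
      then show ?thesis
      proof (cases "i = 1")
        case True
        define s where "s = (j - 2) div 5"
        have "j = 5 * s + 2" using that(4) True unfolding s_def by presburger
        then have "adj a (X j)" using a''[of s] 1 ge True by simp
        then show ?thesis using 1 ge True by (simp add: g_def)
      next
        case False
        then show ?thesis using 1 ge copy_adj(1)[OF X that(4)] by (simp add: g_def)
      qed
    next
      case 2
      define s where "s = (i - 1) div 5"
      have s: "i = 5 * s + 1" using that(4) 2 unfolding s_def by presburger
      then have "i \<noteq> 1 \<Longrightarrow> adj (X i) b" using b''[of s, THEN adj_sym] 2 ge by simp
      then show ?thesis using 2 ge adj_sym[OF ab] ab by (simp add: g_def)
    next
      case 3
      define s where "s = (i - 2) div 5"
      have s: "i = 5 * s + 2" using that(4) 3 unfolding s_def by presburger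
      then have "i \<noteq> ?N \<Longrightarrow> adj (X i) q'" using q''[of s, THEN adj_sym] 3 ge by simp
      moreover have "i = ?N \<or> i < ?N \<and> i \<noteq> 1" using 3 ge s by presburger
      ultimately show ?thesis using 3 ge m l[THEN adj_sym] by (auto simp: g_def)
    next
      case 4
      define s where "s = (i - 3) div 5"
      have s: "i = 5 * s + 3" using that(4) 4 unfolding s_def by presburger
      then have "i \<noteq> ?N + 1 \<Longrightarrow> adj (X i) p'" using p''[of s, THEN adj_sym] 4 ge by simp
      moreover have "i = ?N + 1 \<or> i < ?N \<and> i \<noteq> 1" using 4 ge s by presburger
      ultimately show ?thesis using 4 ge m l[THEN adj_sym] by (auto simp: g_def)
    next
      case 5
      define s where "s = (i - 4) div 5"
      have s: "i = 4 + 5 * s" using that(4) 5 unfolding s_def by presburger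
      then have "i \<noteq> ?N + 2 \<Longrightarrow> adj (X i) v" using v(1)[of s, THEN adj_sym] 5 ge by simp
      moreover have "i = ?N + 2 \<or> i < ?N \<and> i \<noteq> 1" using 5 ge s by presburger
      ultimately show ?thesis using 5 ge m l[THEN adj_sym] by (auto simp: g_def)
    next
      case 6
      define s where "s = i div 5"
      have s: "i = 5 * s" using that(4) 6 unfolding s_def by presburger
      then have "i \<noteq> ?N + 3 \<Longrightarrow> adj (X i) p" using p[of s, THEN adj_sym] 6 ge by simp
      moreover have "i = ?N + 3 \<or> i < ?N \<and> i \<noteq> 1" using 6 ge s by presburger
      ultimately show ?thesis using 6 ge m r r[THEN adj_sym] by (auto simp: g_def)
    next
      case 7
      define s where "s = (i - 1) div 5"
      have s: "i = 5 * s + 1" using that(4) 7 unfolding s_def by presburger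
      then have "i \<noteq> 1 \<Longrightarrow> i \<noteq> ?N + 4 \<Longrightarrow> adj (X i) q" using q[of s, THEN adj_sym] 7 ge by simp
      moreover have "i = ?N + 4 \<or> i < ?N" using 7 ge s by presburger
      ultimately show ?thesis using 7 ge m r r[THEN adj_sym] by (auto simp: g_def)
    qed
  qed
  then have "copy (Suc m) (\<lambda>i. g ((i - 1) mod (5 * int (Suc m) - 3) + 1))" by (intro copyI) auto
  then show ?thesis by blast
qed

text \<open>A copy of \<open>F_1\<close> alternates between the ends of an edge, and a neighbour of
  either end is a clone. So 4-walks join a non-clone to both ends, and they lead to a closed 7-walk,
  which is an \<open>F_2\<close>.\<close>

lemma copy_extend_edge:
  assumes X: "copy 1 X" and v: "v \<in> V" "\<forall>i. \<not> clone 1 X v i"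
  shows "\<exists>Y. copy 2 Y"
proof -
  have clone: "adj v (X (i + 1)) \<Longrightarrow> clone 1 X v i" for i
    unfolding clone_def by (auto simp: int_one_le_iff_zero_less dest: zless_imp_add1_zle)
      (smt (verit) add.commute)
  have nonadj: "\<not> adj v (X i)" for i
  proof
    assume "adj v (X i)"
    then have "clone 1 X v (i - 1)" using clone[of "i - 1"] by simp
    then show False using v(2) by blast
  qed
  have x: "adj (X 0) (X 1)" by (intro copy_adj(1)[OF X]) auto
  obtain a w d where A: "adj v a" "adj a w" "adj w d" "adj d (X 0)"
    using saturated[OF v(1) adj_V[OF x] nonadj] by blast
  obtain a' w' d' where A': "adj v a'" "adj a' w'" "adj w' d'" "adj d' (X 1)"
    using saturated[OF v(1) adj_V[OF adj_sym[OF x]] nonadj] by blast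
  \<comment> \<open>If \<open>X 0\<close> is adjacent to \<open>a\<close>, the closed walk is
    \<open>X 0\<close>, \<open>a\<close>, \<open>v\<close>, \<open>a'\<close>, \<open>w'\<close>,
    \<open>d'\<close>, \<open>X 1\<close>; otherwise a 4-walk from \<open>X 0\<close> to
    \<open>a\<close> is completed by \<open>w\<close> and \<open>d\<close>.\<close>
  have "\<exists>c0 c1 c2 c3 c4 c5 c6. adj c0 c1 \<and> adj c1 c2 \<and> adj c2 c3 \<and> adj c3 c4 \<and> adj c4 c5 \<and> adj c5 c6 \<and> adj c6 c0"
  proof (cases "adj (X 0) a")
    case True
    then show ?thesis using A A' x adj_sym by blast
  next
    case False
    with saturated[OF adj_V[OF x] adj_V[OF A(2)]]
    obtain r s t where "adj (X 0) r" "adj r s" "adj s t" "adj t a" by blast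
    then show ?thesis using A by blast
  qed
  then obtain c0 c1 c2 c3 c4 c5 c6 where c: "adj c0 c1" "adj c1 c2" "adj c2 c3" "adj c3 c4" "adj c4 c5"
    "adj c5 c6" "adj c6 c0" by blast
  define g where "g i = [c0, c1, c2, c3, c4, c5, c6] ! nat (i - 1)" for i :: int
  have "adj (g i) (g j)" if "1 \<le> i" "i < j" "j \<le> 5 * int 2 - 3" "(j - i) mod 5 = 1" for i j
  proof -
    have "i \<in> {1..7}" "j \<in> {1..7}" using that by auto
    moreover have "{1..7} = {1, 2, 3, 4, 5, 6, 7 :: int}" by auto
    ultimately show ?thesis using that c adj_sym[OF c(7)] by (auto simp: g_def)
  qed
  then have "copy 2 (\<lambda>i. g ((i - 1) mod (5 * int 2 - 3) + 1))" by (intro copyI) auto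
  then show ?thesis by blast
qed

theorem clones_or_larger_copy:
  assumes "copy m X" "w \<in> V" "\<forall>i. \<not> clone m X w i"
  shows "\<exists>Y. copy (Suc m) Y"
proof (cases "m = 1")
  case True
  then show ?thesis using copy_extend_edge assms by (simp add: numeral_2_eq_2)
next
  case False
  with assms(1) have m: "m \<ge> 2" by (simp add: copy_def)
  obtain Y v i where Y: "copy m Y" "\<forall>i. \<not> clone m Y v i" "adj v (Y i)"
    using nonclone_with_neighbour[OF assms(1) m assms(2,3)] .
  obtain Z where "copy m Z" "\<And>s. 0 \<le> s \<Longrightarrow> s \<le> int m - 2 \<Longrightarrow> adj v (Z (4 + 5 * s))"
    "\<not> adj v (Z 2)" "\<not> adj v (Z (- 1))"
    by (rule full_run[OF Y]) (rule that)
  then show ?thesis using copy_extend[OF _ m] by blast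
qed

section \<open>Distinctness of the vertices of a copy, and a largest copy\<close>

lemma clone_copy: "copy m X \<Longrightarrow> clone m X (X i) i"
  by (simp add: clone_def copy_def)

text \<open>If \<open>X i = X j\<close>, this vertex is adjacent to \<open>X (i + 1)\<close> and
  \<open>X (i - 1)\<close>, and \<open>adjacent_clones\<close> would force \<open>j - i\<close> to
  be 2, respectively 0, modulo 5. Residue 1 would give a loop.\<close>

lemma copy_inj:
  assumes X: "copy m X" and ij: "i < j" "j < i + (5 * int m - 3)"
  shows "X i \<noteq> X j"
proof
  let ?N = "5 * int m - 3"
  assume eq: "X i = X j"
  have m: "m \<ge> 1" using X by (simp add: copy_def)
  have i1: "adj (X i) (X (i + ?N + 1))"
    using copy_adj(1)[OF X, of "i + 1" i] copy_periodic[OF X, of "i + 1"] m by (simp add: algebra_simps)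
  have i2: "adj (X i) (X (i + ?N - 1))"
    using copy_adj(2)[OF X, of i "i - 1"] copy_periodic[OF X, of "i - 1"] m by (simp add: algebra_simps)
  show False
  proof (cases "(j - i) mod 5 = 1 \<or> (j - i) mod 5 = 2")
    case True
    then show False
    proof
      assume "(j - i) mod 5 = 1"
      then have "adj (X i) (X i)" using copy_adj(1)[OF X _ ij] eq by simp
      then show False using no_pentagon by blast
    next
      assume "(j - i) mod 5 = 2"
      moreover have "(i + ?N - 1 - j) mod 5 = 1"
        using ij i2 unfolding eq
        by (intro adjacent_clones[OF X clone_copy[OF X] clone_copy[OF X]]) auto
      ultimately show False by presburger
    qed
  next
    case False
    then have "j \<noteq> i + 1" by auto
    then have "(i + ?N + 1 - j) mod 5 = 1"
      using ij i1 unfolding eq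
      by (intro adjacent_clones[OF X clone_copy[OF X] clone_copy[OF X]]) auto
    then show False using False by presburger
  qed
qed

lemma clone_representative:
  assumes X: "copy m X" and v: "clone m X v i"
  shows "\<exists>j. 1 \<le> j \<and> j \<le> 5 * int m - 3 \<and> clone m X v j"
proof -
  let ?N = "5 * int m - 3"
  have N: "?N > 0" using X by (simp add: copy_def)
  define j where "j = (i - 1) mod ?N + 1"
  define k where "k = (i - 1) div ?N"
  have i: "i = j + k * ?N"
    using div_mult_mod_eq[of "i - 1" ?N] unfolding j_def k_def by linarith
  have "clone m X v j"
    unfolding clone_def
  proof (intro allI impI)
    fix l assume "j < l" "l < j + ?N" "(l - j) mod 5 = 1"
    then have "adj v (X (l + k * ?N))" using v unfolding clone_def i by (auto simp: algebra_simps)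
    then show "adj v (X l)" using copy_periodic_mult[OF X] by simp
  qed
  moreover have "1 \<le> j" "j \<le> ?N" using N by (simp_all add: j_def add1_zle_eq)
  ultimately show ?thesis by blast
qed

lemma copy_edge:
  assumes "adj a b"
  shows "copy 1 (\<lambda>i. if even i then a else b)"
  unfolding copy_def
proof (intro conjI allI impI)
  fix i j :: int assume "i < j" "j < i + (5 * int 1 - 3)"
  then have "j = i + 1" by simp
  then show "adj (if even i then a else b) (if even j then a else b)" using assms adj_sym by simp
qed auto

text \<open>An edge is a copy of \<open>F_1\<close>, so in the absence of \<open>F_k\<close> the
  chain of copies breaks off at some \<open>m < k\<close>, where
  \<open>clones_or_larger_copy\<close> applies.\<close>

lemma clones_of_largest_copy:
  assumes "adj a b" "\<And>Y. \<not> copy k Y" "k \<ge> 1"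
  obtains m X where "1 \<le> m" "m < k" "copy m X" "\<And>v. v \<in> V \<Longrightarrow> \<exists>i. clone m X v i"
proof -
  have "\<exists>m < k. (\<exists>X. copy m X) \<and> \<not> (\<exists>Y. copy (Suc m) Y)"
  proof (rule ccontr)
    assume *: "\<not> ?thesis"
    have "\<exists>X. copy n X" if "1 \<le> n" "n \<le> k" for n
      using that
    proof (induction n rule: nat_induct_at_least)
      case base
      then show ?case using copy_edge[OF assms(1)] by blast
    next
      case (Suc n)
      then obtain X where "copy n X" by auto
      moreover have "n < k" using Suc.prems by simp
      ultimately show ?case using * by blast
    qed
    then show False using assms(2,3) by blast
  qed
  then obtain m X where "m < k" "copy m X" "\<not> (\<exists>Y. copy (Suc m) Y)" by blast
  moreover have "1 \<le> m" using \<open>copy m X\<close> by (simp add: copy_def)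
  ultimately show ?thesis using clones_or_larger_copy that by blast
qed

end

section \<open>Graphs\<close>

lemma contains_copyI:
  assumes G: "wf_digraph (with_proj G)" and F: "wf_digraph (with_proj F)"
    and f: "inj_on f (pverts F)" "f ` pverts F \<subseteq> pverts G"
      "\<And>u v. (u, v) \<in> parcs F \<Longrightarrow> (f u, f v) \<in> parcs G"
  shows "contains_copy G F"
proof -
  let ?H = "\<lparr>pverts = f ` pverts F, parcs = map_prod f f ` parcs F\<rparr>"
  let ?i = "\<lparr>iso_verts = f, iso_arcs = map_prod f f, iso_head = snd, iso_tail = fst\<rparr>"
  have ends: "u \<in> pverts F" "v \<in> pverts F" if "(u, v) \<in> parcs F" for u v
    using wf_digraph.tail_in_verts[OF F, of "(u, v)"] wf_digraph.head_in_verts[OF F, of "(u, v)"] that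
    by simp_all
  have "subgraph (with_proj ?H) (with_proj G)"
    using G f(2,3) ends by (fastforce simp: subgraph_def wf_digraph_def compatible_def)
  moreover have "inj_on (map_prod f f) (parcs F)"
  proof (rule inj_on_subset[OF map_prod_inj_on[OF f(1) f(1)]])
    show "parcs F \<subseteq> pverts F \<times> pverts F" using ends by auto
  qed
  then have "pre_digraph.digraph_isomorphism (with_proj F) ?i"
    using F f(1) by (simp add: pre_digraph.digraph_isomorphism_def)
  moreover have "with_proj ?H = app_iso ?i (with_proj F)"
    by (simp add: app_iso_def with_proj_def)
  ultimately show ?thesis
    unfolding contains_copy_def digraph_iso_def by blast
qed

lemma contains_copyE:
  assumes "contains_copy G F"
  obtains f where "inj_on f (pverts F)" "\<And>u v. (u, v) \<in> parcs F \<Longrightarrow> (f u, f v) \<in> parcs G"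
proof -
  obtain H h where H: "subgraph (with_proj H) (with_proj G)"
    and h: "pre_digraph.digraph_isomorphism (with_proj F) h" "with_proj H = app_iso h (with_proj F)"
    using assms by (auto simp: contains_copy_def digraph_iso_def)
  have "(iso_verts h u, iso_verts h v) \<in> parcs G" if uv: "(u, v) \<in> parcs F" for u v
  proof -
    have "iso_tail h = fst" "iso_head h = snd" "parcs H = iso_arcs h ` parcs F"
      using arg_cong[OF h(2), of tail] arg_cong[OF h(2), of head] arg_cong[OF h(2), of arcs] by simp_all
    moreover have "iso_verts h u = iso_tail h (iso_arcs h (u, v))" "iso_verts h v = iso_head h (iso_arcs h (u, v))"
      using h(1) uv by (auto simp: pre_digraph.digraph_isomorphism_def)
    ultimately have "(iso_verts h u, iso_verts h v) \<in> parcs H" using uv by simp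
    then show ?thesis using H by (auto simp: subgraph_def)
  qed
  moreover have "inj_on (iso_verts h) (pverts F)"
    using h(1) by (simp add: pre_digraph.digraph_isomorphism_def)
  ultimately show ?thesis using that by blast
qed

lemma wf_cycle_graph: "wf_digraph (with_proj (cycle_graph l))"
  by (auto simp: wf_digraph_def cycle_graph_def)

lemma wf_F_graph: "wf_digraph (with_proj (F_graph k))"
  by (auto simp: wf_digraph_def F_graph_def)

lemma contains_cycleI:
  assumes G: "pair_graph G" and vs: "distinct vs" "length vs = l"
    and arcs: "\<And>i. i < l \<Longrightarrow> (vs ! i, vs ! ((i + 1) mod l)) \<in> parcs G"
  shows "contains_copy G (cycle_graph l)"
proof -
  interpret pair_graph G by fact
  have sym: "(v, u) \<in> parcs G" if "(u, v) \<in> parcs G" for u v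
    using that pair_sym_arcs by (auto simp: symmetric_def dest: symD)
  show ?thesis
  proof (rule contains_copyI[OF _ wf_cycle_graph, where f = "nth vs"])
    show "wf_digraph (with_proj G)" by unfold_locales
    show "inj_on ((!) vs) (pverts (cycle_graph l))"
      using vs by (auto simp: cycle_graph_def inj_on_def nth_eq_iff_index_eq)
    show "(!) vs ` pverts (cycle_graph l) \<subseteq> pverts G"
      using in_arcsD1[OF arcs] by (auto simp: cycle_graph_def)
    show "(vs ! u, vs ! v) \<in> parcs G" if "(u, v) \<in> parcs (cycle_graph l)" for u v
      using that arcs sym by (auto simp: cycle_graph_def)
  qed
qed

text \<open>A closed 5-walk without loops either is a 5-cycle or has two coinciding vertices at
  distance two, and then its other three edges form a triangle.\<close>

lemma C3_C5_free_no_pentagon: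
  assumes G: "pair_graph G" and free: "C3_C5_free G"
    and arcs: "(a, b) \<in> parcs G" "(b, c) \<in> parcs G" "(c, d) \<in> parcs G" "(d, e) \<in> parcs G"
  shows "(a, e) \<notin> parcs G"
proof
  interpret pair_graph G by fact
  assume ae: "(a, e) \<in> parcs G"
  have sym: "(v, u) \<in> parcs G" if "(u, v) \<in> parcs G" for u v
    using that pair_sym_arcs by (auto simp: symmetric_def dest: symD)
  have irrefl: "(u, u) \<notin> parcs G" for u using pair_no_loops[of "(u, u)"] by auto
  have triangle: False if t: "(x, y) \<in> parcs G" "(y, z) \<in> parcs G" "(z, x) \<in> parcs G" for x y z
  proof -
    have "([x, y, z] ! i, [x, y, z] ! ((i + 1) mod 3)) \<in> parcs G" if "i < 3" for i
    proof -
      have "i = 0 \<or> i = 1 \<or> i = 2" using that by linarith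
      then show ?thesis using t by auto
    qed
    moreover have "x \<noteq> y" "y \<noteq> z" "z \<noteq> x" using t irrefl by metis+
    ultimately have "contains_copy G (cycle_graph 3)"
      by (intro contains_cycleI[OF G, of "[x, y, z]"]) simp_all
    then show False using free by (simp add: C3_C5_free_def)
  qed
  have "a \<noteq> b" "b \<noteq> c" "c \<noteq> d" "d \<noteq> e" "e \<noteq> a" using arcs ae irrefl by metis+
  moreover have "a \<noteq> c" "a \<noteq> d" "b \<noteq> d" "b \<noteq> e" "c \<noteq> e"
    using triangle[of c d e] triangle[of a b c] triangle[of a b e] triangle[of b c d] arcs sym[OF ae] by blast+
  ultimately have "distinct [a, b, c, d, e]" by simp
  moreover have "([a, b, c, d, e] ! i, [a, b, c, d, e] ! ((i + 1) mod 5)) \<in> parcs G" if "i < 5" for i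
  proof -
    have "i = 0 \<or> i = 1 \<or> i = 2 \<or> i = 3 \<or> i = 4" using that by linarith
    then show ?thesis using arcs sym[OF ae] by auto
  qed
  ultimately have "contains_copy G (cycle_graph 5)"
    by (intro contains_cycleI[OF G, of "[a, b, c, d, e]"]) simp_all
  then show False using free by (simp add: C3_C5_free_def)
qed

lemma cycle_graph_arc: "i < l \<Longrightarrow> (i, (i + 1) mod l) \<in> parcs (cycle_graph l)"
  by (auto simp: cycle_graph_def)

text \<open>One edge of the cycle created is \<open>uv\<close>; the others lie in \<open>G\<close>
  and form a walk of length 4, or one of length 2 that is prolonged by backtracking.\<close>

lemma maximal_C3_C5_free_walk:
  assumes G: "pair_graph G" and max: "maximal_C3_C5_free G"
    and uv: "u \<in> pverts G" "v \<in> pverts G" "u \<noteq> v" "(u, v) \<notin> parcs G"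
  shows "\<exists>x y z. (u, x) \<in> parcs G \<and> (x, y) \<in> parcs G \<and> (y, z) \<in> parcs G \<and> (z, v) \<in> parcs G"
proof -
  interpret pair_graph G by fact
  have sym: "(v, u) \<in> parcs G" if "(u, v) \<in> parcs G" for u v
    using that pair_sym_arcs by (auto simp: symmetric_def dest: symD)
  let ?E = "parcs G \<union> {(u, v), (v, u)}"
  have free: "C3_C5_free G" and "\<not> C3_C5_free (add_edge G u v)"
    using max uv by (auto simp: maximal_C3_C5_free_def)
  then consider "contains_copy (add_edge G u v) (cycle_graph 3)" | "contains_copy (add_edge G u v) (cycle_graph 5)"
    by (auto simp: C3_C5_free_def)
  then show ?thesis
  proof cases
    case 1
    then obtain f where f: "inj_on f (pverts (cycle_graph 3))"
      and arcs: "\<And>i j. (i, j) \<in> parcs (cycle_graph 3) \<Longrightarrow> (f i, f j) \<in> parcs (add_edge G u v)"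
      by (rule contains_copyE) (rule that)
    have "(f i, f ((i + 1) mod 3)) \<in> ?E" if "i < 3" for i
      using arcs[OF cycle_graph_arc[OF that]] by (simp add: add_edge_def)
    from this[of 0] this[of 1] this[of 2]
    have E: "(f 0, f 1) \<in> ?E" "(f 1, f 2) \<in> ?E" "(f 2, f 0) \<in> ?E"
      by (simp_all add: numeral_2_eq_2)
    have dist: "distinct [f 0, f 1, f 2]"
      using f by (simp add: cycle_graph_def inj_on_eq_iff)
    \<comment> \<open>A triangle with one edge traversed three times is a closed 5-walk.\<close>
    have "\<not> ((f 0, f 1) \<in> parcs G \<and> (f 1, f 2) \<in> parcs G \<and> (f 2, f 0) \<in> parcs G)"
      using C3_C5_free_no_pentagon[OF G free, of "f 0" "f 1" "f 0" "f 1" "f 2"] sym by blast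
    \<comment> \<open>The cycle is rotated so that its edge outside \<open>G\<close> comes first; as
      its vertices are distinct, all other edges are in \<open>G\<close>.\<close>
    moreover have through: ?thesis
      if d: "distinct [a, b, c]"
        and e: "(a, b) \<in> ?E" "(b, c) \<in> ?E" "(c, a) \<in> ?E" "(a, b) \<notin> parcs G"
      for a b c
    proof -
      have "(b, c) \<in> parcs G" "(c, a) \<in> parcs G" using d e by auto
      moreover have "(a, b) = (u, v) \<or> (a, b) = (v, u)" using e by blast
      ultimately show ?thesis using sym by blast
    qed
    moreover have "distinct [f 1, f 2, f 0]" "distinct [f 2, f 0, f 1]" using dist by auto
    ultimately show ?thesis
      using through[OF dist E] through[OF _ E(2,3,1)] through[OF _ E(3,1,2)] by blast
  next
    case 2
    then obtain f where f: "inj_on f (pverts (cycle_graph 5))"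
      and arcs: "\<And>i j. (i, j) \<in> parcs (cycle_graph 5) \<Longrightarrow> (f i, f j) \<in> parcs (add_edge G u v)"
      by (rule contains_copyE) (rule that)
    have "(f i, f ((i + 1) mod 5)) \<in> ?E" if "i < 5" for i
      using arcs[OF cycle_graph_arc[OF that]] by (simp add: add_edge_def)
    from this[of 0] this[of 1] this[of 2] this[of 3] this[of 4]
    have E: "(f 0, f 1) \<in> ?E" "(f 1, f 2) \<in> ?E" "(f 2, f 3) \<in> ?E" "(f 3, f 4) \<in> ?E" "(f 4, f 0) \<in> ?E"
      by (simp_all add: numeral_2_eq_2)
    have dist: "distinct [f 0, f 1, f 2, f 3, f 4]"
      using f by (simp add: cycle_graph_def inj_on_eq_iff)
    have "\<not> ((f 0, f 1) \<in> parcs G \<and> (f 1, f 2) \<in> parcs G \<and> (f 2, f 3) \<in> parcs G \<and> (f 3, f 4) \<in> parcs G \<and> (f 4, f 0) \<in> parcs G)"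
      using C3_C5_free_no_pentagon[OF G free, of "f 0" "f 1" "f 2" "f 3" "f 4"] sym by blast
    moreover have through: ?thesis
      if d: "distinct [a, b, c, d, e]"
        and e: "(a, b) \<in> ?E" "(b, c) \<in> ?E" "(c, d) \<in> ?E" "(d, e) \<in> ?E" "(e, a) \<in> ?E" "(a, b) \<notin> parcs G"
      for a b c d e
    proof -
      have "(b, c) \<in> parcs G" "(c, d) \<in> parcs G" "(d, e) \<in> parcs G" "(e, a) \<in> parcs G" using d e by auto
      moreover have "(a, b) = (u, v) \<or> (a, b) = (v, u)" using e by blast
      ultimately show ?thesis using sym by blast
    qed
    moreover have "distinct [f 1, f 2, f 3, f 4, f 0]" "distinct [f 2, f 3, f 4, f 0, f 1]"
      "distinct [f 3, f 4, f 0, f 1, f 2]" "distinct [f 4, f 0, f 1, f 2, f 3]"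
      using dist by auto
    ultimately show ?thesis
      using through[OF dist E] through[OF _ E(2,3,4,5,1)] through[OF _ E(3,4,5,1,2)]
        through[OF _ E(4,5,1,2,3)] through[OF _ E(5,1,2,3,4)] by blast
  qed
qed

section \<open>From maximal graphs of large minimum degree to the homomorphism\<close>

lemma out_degree_eq_card: "out_degree (with_proj G) u = card {v. (u, v) \<in> parcs G}"
proof -
  have "out_arcs (with_proj G) u = Pair u ` {v. (u, v) \<in> parcs G}"
    by (auto simp: out_arcs_def)
  then show ?thesis by (simp add: out_degree_def card_image inj_on_def)
qed

lemma dense_maximal_pair_graph:
  assumes G: "pair_graph G" and max: "maximal_C3_C5_free G"
    and deg: "real (min_degree G) > real (card (pverts G)) / 5"
  shows "dense_maximal (pverts G) (\<lambda>u v. (u, v) \<in> parcs G)"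
proof -
  interpret pair_graph G by fact
  have dense: "card (pverts G) < 5 * card {v. (u, v) \<in> parcs G}" if "u \<in> pverts G" for u
  proof -
    have "min_degree G \<le> out_degree (with_proj G) u"
      unfolding min_degree_def using that pair_finite_verts by (intro Min_le) auto
    then have "real (card (pverts G)) < 5 * real (card {v. (u, v) \<in> parcs G})"
      using deg unfolding out_degree_eq_card by linarith
    then show ?thesis by linarith
  qed
  have sym: "(v, u) \<in> parcs G" if "(u, v) \<in> parcs G" for u v
    using that pair_sym_arcs by (auto simp: symmetric_def dest: symD)
  show ?thesis
  proof
    show "finite (pverts G)" by (rule pair_finite_verts)
    show "(v, u) \<in> parcs G" if "(u, v) \<in> parcs G" for u v by (rule sym[OF that])
    show "u \<in> pverts G" if "(u, v) \<in> parcs G" for u v using in_arcsD1[OF that] .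
    show "card (pverts G) < 5 * card {v. (u, v) \<in> parcs G}" if "u \<in> pverts G" for u by (rule dense[OF that])
    show "(u, v) \<notin> parcs G" if "(u, x) \<in> parcs G" "(x, y) \<in> parcs G" "(y, z) \<in> parcs G" "(z, v) \<in> parcs G" for u v x y z
      using C3_C5_free_no_pentagon[OF G _ that] max by (simp add: maximal_C3_C5_free_def)
    show "\<exists>x y z. (u, x) \<in> parcs G \<and> (x, y) \<in> parcs G \<and> (y, z) \<in> parcs G \<and> (z, v) \<in> parcs G"
      if "u \<in> pverts G" "v \<in> pverts G" "(u, v) \<notin> parcs G" for u v
    proof (cases "u = v")
      case True
      \<comment> \<open>For \<open>u = v\<close> the 4-walk goes back and forth along an edge, which
        exists by the degree condition.\<close>
      have "{v. (u, v) \<in> parcs G} \<noteq> {}" using dense[OF that(1)] by (metis card.empty mult_0_right not_less0)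
      then show ?thesis using True sym by blast
    qed (use maximal_C3_C5_free_walk[OF G max that(1,2)] that(3) in blast)
  qed
qed

theorem theorem6p2:
  fixes G :: "'a pair_pre_digraph" and k :: nat
  assumes "pair_graph G"
    and "maximal_C3_C5_free G"
    and "real (min_degree G) > real (card (pverts G)) / 5"
    and "k \<ge> 2"
    and "\<not> contains_copy G (F_graph k)"
  shows "homomorphic_to G (F_graph (k - 1))"
proof (cases "parcs G = {}")
  case True
  \<comment> \<open>Without edges there is no copy of \<open>F_1\<close> to start from, but a
    constant map is a homomorphism.\<close>
  have "(1::nat) \<in> pverts (F_graph (k - 1))" using assms(4) by (auto simp: F_graph_def)
  then show ?thesis using True by (auto simp: homomorphic_to_def intro!: exI[of _ "\<lambda>_. 1"])
next
  case False
  then obtain a b where ab: "(a, b) \<in> parcs G" by auto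
  interpret dense_maximal "pverts G" "\<lambda>u v. (u, v) \<in> parcs G"
    by (rule dense_maximal_pair_graph[OF assms(1-3)])
  have no_copy: "\<not> copy k Y" for Y
  proof
    assume Y: "copy k Y"
    have "contains_copy G (F_graph k)"
    proof (rule contains_copyI[OF _ wf_F_graph, where f = "\<lambda>i. Y (int i)"])
      show "wf_digraph (with_proj G)"
        using assms(1) by (simp add: pair_graph_def pair_digraph_def pair_fin_digraph_def wf_digraph_wp_iff)
      have bound: "int i \<le> 5 * int k - 3" if "i \<le> 5 * k - 3" for i using that assms(4) by linarith
      have le: "i = j" if "Y (int i) = Y (int j)" "1 \<le> i" "j \<le> 5 * k - 3" "i \<le> j" for i j
      proof (rule ccontr)
        assume "i \<noteq> j"
        then show False using copy_inj[OF Y, of "int i" "int j"] that bound[of j] by simp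
      qed
      show "inj_on (\<lambda>i. Y (int i)) (pverts (F_graph k))"
      proof (rule inj_onI)
        fix i j assume "i \<in> pverts (F_graph k)" "j \<in> pverts (F_graph k)" "Y (int i) = Y (int j)"
        then show "i = j" using le[of i j] le[of j i] by (cases "i \<le> j") (simp_all add: F_graph_def)
      qed
      have lt: "(Y (int i), Y (int j)) \<in> parcs G"
        if "1 \<le> i" "j \<le> 5 * k - 3" "i < j" "(int j - int i) mod 5 = 1" for i j
        using that bound[of j] by (intro copy_adj(1)[OF Y]) auto
      show "(Y (int i), Y (int j)) \<in> parcs G" if ij: "(i, j) \<in> parcs (F_graph k)" for i j
      proof -
        have ij: "1 \<le> i" "i \<le> 5 * k - 3" "1 \<le> j" "j \<le> 5 * k - 3" "\<bar>int i - int j\<bar> mod 5 = 1"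
          using ij by (auto simp: F_graph_def)
        consider "i < j" | "j < i" | "i = j" by linarith
        then show ?thesis
        proof cases
          case 1
          then show ?thesis using ij by (intro lt) auto
        next
          case 2
          then show ?thesis using ij by (intro adj_sym[OF lt]) auto
        qed (use ij in simp)
      qed
      have "Y i \<in> pverts G" for i
        using copy_adj(1)[OF Y, of "i + 1" i] assms(4) adj_V by simp
      then show "(\<lambda>i. Y (int i)) ` pverts (F_graph k) \<subseteq> pverts G" by blast
    qed
    then show False using assms(5) by blast
  qed
  obtain m X where m: "1 \<le> m" "m < k" and X: "copy m X"
    and clone: "\<And>v. v \<in> pverts G \<Longrightarrow> \<exists>i. clone m X v i"
    by (rule clones_of_largest_copy[OF ab no_copy]) (use assms(4) in simp, rule that)
  have "\<forall>v \<in> pverts G. \<exists>i. 1 \<le> i \<and> i \<le> 5 * int m - 3 \<and> clone m X v i"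
    using clone clone_representative[OF X] by blast
  then obtain c where c: "\<And>v. v \<in> pverts G \<Longrightarrow> 1 \<le> c v \<and> c v \<le> 5 * int m - 3 \<and> clone m X v (c v)"
    by metis
  have le: "(c v - c u) mod 5 = 1" if "(u, v) \<in> parcs G" "c u \<le> c v" for u v
    using c[OF adj_V[OF that(1)]] c[OF adj_V[OF adj_sym[OF that(1)]]] that(2)
    by (intro adjacent_clones[OF X _ _ that(1,2)]) simp_all
  have mod: "\<bar>c u - c v\<bar> mod 5 = 1" if "(u, v) \<in> parcs G" for u v
    using le[of u v] le[of v u] adj_sym[OF that] that by (cases "c u \<le> c v") (auto simp: abs_if)
  \<comment> \<open>As \<open>m \<le> k - 1\<close>, \<open>F_m\<close> is induced in
    \<open>F_(k-1)\<close> by an initial segment of the vertices, so the labels \<open>c v\<close>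
    can be kept.\<close>
  have range: "nat (c v) \<in> {1..5 * (k - 1) - 3} \<and> int (nat (c v)) = c v" if "v \<in> pverts G" for v
    using c[OF that] m by auto
  show ?thesis
    unfolding homomorphic_to_def
  proof (intro exI[of _ "\<lambda>v. nat (c v)"] conjI ballI)
    show "(\<lambda>v. nat (c v)) ` pverts G \<subseteq> pverts (F_graph (k - 1))"
      using range by (auto simp: F_graph_def)
    fix e assume "e \<in> parcs G"
    moreover obtain u v where e: "e = (u, v)" by (cases e)
    ultimately have uv: "(u, v) \<in> parcs G" by simp
    have "(nat (c u), nat (c v)) \<in> parcs (F_graph (k - 1))"
      using mod[OF uv] range[OF adj_V[OF uv]] range[OF adj_V[OF adj_sym[OF uv]]]
      by (simp add: F_graph_def)
    then show "case e of (u, v) \<Rightarrow> (nat (c u), nat (c v)) \<in> parcs (F_graph (k - 1))" by (simp add: e)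
  qed
qed

end
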